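(* There is an algorithm which, given a circuit $G$ with leaves labeled by literals over $\mathbf{I}$ and $\mathbf{X}$ and a sequence $S=(S_1,\dots,S_k)$ of sets of leaves such that $G$ is in SAUNF with respect to $\mathrm{set}(\mathbf{X})$ and $S$, returns a Skolem function vector for $\mathbf{X}$ in $\varphi_G(\mathbf{X},\mathbf{I})$ of size $O(|S|^2\cdot|G|)$, in time $O(|S|^2\cdot|G|)$.
   Context: Boolean values are $\bot,\top$. $\mathbf{I}=(i_1,\dots,i_n)$ (system inputs) and $\mathbf{X}=(x_1,\dots,x_m)$ (system outputs) are disjoint sequences of Boolean variables; $\mathrm{set}(\mathbf{V})$ is the set of variables of $\mathbf{V}$. A circuit is an NNF circuit: a rooted DAG whose nodes are all descendants of the root, internal nodes labeled $\wedge$ or $\vee$ with exactly two children, leaves labeled by literals or constants $\top,\bot$ (labels may repeat). $|G|$ is the number of nodes; $\varphi_G$ is the represented formula and $[\![\varphi_G]\!]$ its Boolean function. An $\ell$-leaf is a leaf labeled $\ell$; a set of leaves is literal-consistent if all carry the same literal. $G|_{L:b}$ relabels each leaf in $L$ by $b$; $G|_{\ell_1=b_1,\dots}$ relabels all $\ell_j$-leaves by $b_j$ ($\ell$ and $\neg\ell$ are distinct literals). $[\![\varphi]\!]_\sigma$ denotes substitution of an assignment $\sigma$. For a literal $\ell$ labeling a leaf of $G$ with variable $v_\ell$ and fresh $w,w'$: $\ell$ is $\wedge$-realizable in $G$ iff some assignment $\sigma$ of $(\mathrm{set}(\mathbf{I})\cup\mathrm{set}(\mathbf{X}))\setminus\{v_\ell\}$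 gives $[\![G|_{\ell=w,\neg\ell=w'}]\!]_\sigma=[\![w\wedge w']\!]$, else $\wedge$-unrealizable. A literal-consistent set $S$ of $\ell$-leaves, with $S'$ all $\ell$-leaves of $G$, is $\wedge$-(un)realizable in $G$ iff $\ell$ is $\wedge$-(un)realizable in $G|_{S'\setminus S:\bot}$. $G$ is in SAUNF w.r.t. $\mathrm{set}(\mathbf{X})$ and a non-empty sequence $S=(S_1,\dots,S_k)$ of leaf sets iff: the $S_j$ are pairwise disjoint; each $S_j$ is literal-consistent with a literal over $\mathbf{X}$; $S_1$ is $\wedge$-unrealizable in $G$; for $2\le j\le k$, $S_j$ is $\wedge$-unrealizable in $G|_{S_1:\top,\dots,S_{j-1}:\top}$; and $[\![\varphi_{G|_{S_1:\top,\dots,S_k:\top}}]\!]$ does not depend on $\mathbf{X}$. A Skolem function vector for $\mathbf{X}$ in $\varphi_G(\mathbf{X},\mathbf{I})$ is a sequence $(\psi_1(\mathbf{I}),\dots,\psi_m(\mathbf{I}))$ of circuits over $\mathbf{I}$ with $\forall\mathbf{I}\,(\varphi_G(\Psi(\mathbf{I}),\mathbf{I})\Leftrightarrow\exists\mathbf{X}\varphi_G(\mathbf{X},\mathbf{I}))$; its size is the total size of these circuits.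
   Formalization: The size and time bounds are O(|S|²·|G| + r), where r is the number of variables of X that label no leaf of G; without r the claim fails, since each of the m output circuits has at least one node. If all of X occurs in G, r = 0. *)

theory Defs
  imports Main
begin

section \<open>NNF circuits\<close>

datatype literal = Pos nat | Neg nat

fun lit_var :: "literal \<Rightarrow> nat" where
  "lit_var (Pos v) = v"
| "lit_var (Neg v) = v"

fun lit_neg :: "literal \<Rightarrow> literal" where
  "lit_neg (Pos v) = Neg v"
| "lit_neg (Neg v) = Pos v"

fun lit_val :: "literal \<Rightarrow> (nat \<Rightarrow> bool) \<Rightarrow> bool" where
  "lit_val (Pos v) \<sigma> = \<sigma> v"
| "lit_val (Neg v) \<sigma> = (\<not> \<sigma> v)"

datatype label = Lit literal | Cst bool

datatype node = Leaf label | AndN nat nat | OrN nat nat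

text \<open>The nodes of a circuit are the positions of its node list. The numbering is arbitrary: it
  need not be a topological order.\<close>

datatype circuit = Circuit (nodes: "node list") (croot: nat)

definition csize :: "circuit \<Rightarrow> nat" where
  "csize G = length (nodes G)"

fun children :: "node \<Rightarrow> nat set" where
  "children (Leaf _) = {}"
| "children (AndN a b) = {a, b}"
| "children (OrN a b) = {a, b}"

fun two_children :: "node \<Rightarrow> bool" where
  "two_children (Leaf _) = True"
| "two_children (AndN a b) = (a \<noteq> b)"
| "two_children (OrN a b) = (a \<noteq> b)"

definition edges :: "circuit \<Rightarrow> (nat \<times> nat) set" where
  "edges G = {(u, v). u < csize G \<and> v \<in> children (nodes G ! u)}"

definition wf_circuit :: "circuit \<Rightarrow> bool" where
  "wf_circuit G \<longleftrightarrow>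
     croot G < csize G \<and>
     (\<forall>u < csize G. children (nodes G ! u) \<subseteq> {..<csize G} \<and> two_children (nodes G ! u)) \<and>
     acyclic (edges G) \<and>
     (\<forall>u < csize G. (croot G, u) \<in> (edges G)\<^sup>*)"

definition circuit_vars :: "circuit \<Rightarrow> nat set" where
  "circuit_vars G = {lit_var l | l. Leaf (Lit l) \<in> set (nodes G)}"

definition circuit_over :: "nat set \<Rightarrow> circuit \<Rightarrow> bool" where
  "circuit_over V G \<longleftrightarrow> wf_circuit G \<and> circuit_vars G \<subseteq> V"

datatype formula = FLeaf label | FAnd formula formula | FOr formula formula

inductive node_formula :: "circuit \<Rightarrow> nat \<Rightarrow> formula \<Rightarrow> bool" for G where
  leaf: "u < csize G \<Longrightarrow> nodes G ! u = Leaf b \<Longrightarrow> node_formula G u (FLeaf b)"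
| conj: "u < csize G \<Longrightarrow> nodes G ! u = AndN a b \<Longrightarrow> node_formula G a \<phi> \<Longrightarrow> node_formula G b \<psi>
    \<Longrightarrow> node_formula G u (FAnd \<phi> \<psi>)"
| disj: "u < csize G \<Longrightarrow> nodes G ! u = OrN a b \<Longrightarrow> node_formula G a \<phi> \<Longrightarrow> node_formula G b \<psi>
    \<Longrightarrow> node_formula G u (FOr \<phi> \<psi>)"

text \<open>Exactly one such formula exists whenever \<^term>\<open>wf_circuit G\<close> holds.\<close>

definition formula_of :: "circuit \<Rightarrow> formula" where
  "formula_of G = (THE \<phi>. node_formula G (croot G) \<phi>)"

fun label_val :: "label \<Rightarrow> (nat \<Rightarrow> bool) \<Rightarrow> bool" where
  "label_val (Lit l) \<sigma> = lit_val l \<sigma>"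
| "label_val (Cst b) \<sigma> = b"

fun sem :: "formula \<Rightarrow> (nat \<Rightarrow> bool) \<Rightarrow> bool" where
  "sem (FLeaf b) \<sigma> = label_val b \<sigma>"
| "sem (FAnd \<phi> \<psi>) \<sigma> = (sem \<phi> \<sigma> \<and> sem \<psi> \<sigma>)"
| "sem (FOr \<phi> \<psi>) \<sigma> = (sem \<phi> \<sigma> \<or> sem \<psi> \<sigma>)"

definition circuit_fun :: "circuit \<Rightarrow> (nat \<Rightarrow> bool) \<Rightarrow> bool" where
  "circuit_fun G = sem (formula_of G)"

section \<open>SAUNF\<close>

definition lit_leaves :: "circuit \<Rightarrow> literal \<Rightarrow> nat set" where
  "lit_leaves G l = {u. u < csize G \<and> nodes G ! u = Leaf (Lit l)}"

definition relabel :: "circuit \<Rightarrow> nat set \<Rightarrow> label \<Rightarrow> circuit" where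
  "relabel G L b =
     Circuit (map (\<lambda>u. if u \<in> L then Leaf b else nodes G ! u) [0..<csize G]) (croot G)"

definition relabel_pair :: "circuit \<Rightarrow> literal \<Rightarrow> nat \<Rightarrow> nat \<Rightarrow> circuit" where
  "relabel_pair G l w w' =
     relabel (relabel G (lit_leaves G l) (Lit (Pos w))) (lit_leaves G (lit_neg l)) (Lit (Pos w'))"

text \<open>\<open>V\<close> is the set of all variables in play; it only serves to make \<open>w\<close> and \<open>w'\<close> fresh. The
  assignment \<open>\<sigma>\<close> is total, but its values outside \<open>V\<close> and at the variable of \<open>l\<close> are irrelevant,
  because no leaf of the relabeled circuit other than \<open>w\<close> and \<open>w'\<close> refers to them.\<close>

definition and_realizable :: "nat set \<Rightarrow> circuit \<Rightarrow> literal \<Rightarrow> bool" where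
  "and_realizable V G l \<longleftrightarrow>
     (\<exists>\<sigma> w w'. w \<notin> V \<and> w' \<notin> V \<and> w \<noteq> w' \<and>
        (\<forall>b b'. circuit_fun (relabel_pair G l w w') (\<sigma>(w := b, w' := b')) = (b \<and> b')))"

text \<open>For nonempty \<open>L\<close> the literal \<open>l\<close> is determined by \<open>L\<close>. The empty set is never realizable,
  since then no leaf labeled \<open>l\<close> survives.\<close>

definition and_realizable_set :: "nat set \<Rightarrow> circuit \<Rightarrow> nat set \<Rightarrow> bool" where
  "and_realizable_set V G L \<longleftrightarrow>
     (\<exists>l. L \<subseteq> lit_leaves G l \<and> and_realizable V (relabel G (lit_leaves G l - L) (Cst False)) l)"

text \<open>For \<open>j = 0\<close> nothing is relabeled, so the first set is tested in \<open>G\<close> itself.\<close>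

definition saunf :: "nat list \<Rightarrow> nat list \<Rightarrow> circuit \<Rightarrow> nat set list \<Rightarrow> bool" where
  "saunf I X G S \<longleftrightarrow>
     S \<noteq> [] \<and>
     (\<forall>i < length S. \<forall>j < length S. i \<noteq> j \<longrightarrow> S ! i \<inter> S ! j = {}) \<and>
     (\<forall>L \<in> set S. \<exists>l. lit_var l \<in> set X \<and> L \<subseteq> lit_leaves G l) \<and>
     (\<forall>j < length S.
        \<not> and_realizable_set (set I \<union> set X) (relabel G (\<Union>i<j. S ! i) (Cst True)) (S ! j)) \<and>
     (\<forall>\<sigma> \<tau>. (\<forall>v. v \<notin> set X \<longrightarrow> \<sigma> v = \<tau> v) \<longrightarrow>
        circuit_fun (relabel G (\<Union>(set S)) (Cst True)) \<sigma> =
        circuit_fun (relabel G (\<Union>(set S)) (Cst True)) \<tau>)"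

section \<open>Skolem function vectors\<close>

definition subst_outputs :: "nat list \<Rightarrow> circuit list \<Rightarrow> (nat \<Rightarrow> bool) \<Rightarrow> nat \<Rightarrow> bool" where
  "subst_outputs X \<Psi> \<sigma> v =
     (case map_of (zip X \<Psi>) v of Some \<psi> \<Rightarrow> circuit_fun \<psi> \<sigma> | None \<Rightarrow> \<sigma> v)"

definition skolem_vector :: "nat list \<Rightarrow> nat list \<Rightarrow> circuit \<Rightarrow> circuit list \<Rightarrow> bool" where
  "skolem_vector I X G \<Psi> \<longleftrightarrow>
     length \<Psi> = length X \<and>
     (\<forall>\<psi> \<in> set \<Psi>. circuit_over (set I) \<psi>) \<and>
     (\<forall>\<sigma>. circuit_fun G (subst_outputs X \<Psi> \<sigma>) \<longleftrightarrow>
          (\<exists>\<tau>. (\<forall>v. v \<notin> set X \<longrightarrow> \<tau> v = \<sigma> v) \<and> circuit_fun G \<tau>))"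

definition vector_size :: "circuit list \<Rightarrow> nat" where
  "vector_size \<Psi> = sum_list (map csize \<Psi>)"

section \<open>Random access machine programs with running time\<close>

text \<open>
  A structured random access machine under the uniform cost measure. The store consists of
  registers and arrays holding natural numbers; a program mentions only finitely many of either,
  while each array has unboundedly many cells. The only arithmetic is successor and predecessor.
  Hence a run of \<open>t\<close> steps exceeds the largest number in the input and in the program by at most
  \<open>t\<close>, and the unit cost cannot be abused by building up huge numbers.
\<close>

record state =
  regs :: "nat \<Rightarrow> nat"
  arrs :: "nat \<Rightarrow> nat \<Rightarrow> nat"

datatype exp = Num nat | Reg nat | Cell nat exp | Inc exp | Dec exp

datatype test = Less exp exp | Eq exp exp | Not test | And test test

datatype com =
    Skip
  | Assign nat exp
  | Store nat exp exp
  | Seq com com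
  | If test com com
  | While test com

fun exp_val :: "exp \<Rightarrow> state \<Rightarrow> nat" where
  "exp_val (Num n) s = n"
| "exp_val (Reg r) s = regs s r"
| "exp_val (Cell a e) s = arrs s a (exp_val e s)"
| "exp_val (Inc e) s = exp_val e s + 1"
| "exp_val (Dec e) s = exp_val e s - 1"

fun exp_cost :: "exp \<Rightarrow> nat" where
  "exp_cost (Num n) = 1"
| "exp_cost (Reg r) = 1"
| "exp_cost (Cell a e) = exp_cost e + 1"
| "exp_cost (Inc e) = exp_cost e + 1"
| "exp_cost (Dec e) = exp_cost e + 1"

fun test_val :: "test \<Rightarrow> state \<Rightarrow> bool" where
  "test_val (Less e f) s = (exp_val e s < exp_val f s)"
| "test_val (Eq e f) s = (exp_val e s = exp_val f s)"
| "test_val (Not b) s = (\<not> test_val b s)"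
| "test_val (And b c) s = (test_val b s \<and> test_val c s)"

fun test_cost :: "test \<Rightarrow> nat" where
  "test_cost (Less e f) = exp_cost e + exp_cost f + 1"
| "test_cost (Eq e f) = exp_cost e + exp_cost f + 1"
| "test_cost (Not b) = test_cost b + 1"
| "test_cost (And b c) = test_cost b + test_cost c + 1"

definition set_reg :: "nat \<Rightarrow> nat \<Rightarrow> state \<Rightarrow> state" where
  "set_reg r x s = s\<lparr>regs := (regs s)(r := x)\<rparr>"

definition set_cell :: "nat \<Rightarrow> nat \<Rightarrow> nat \<Rightarrow> state \<Rightarrow> state" where
  "set_cell a i x s = s\<lparr>arrs := (arrs s)(a := (arrs s a)(i := x))\<rparr>"

text \<open>\<open>exec p s t s'\<close>: started in \<open>s\<close>, the program \<open>p\<close> halts in \<open>s'\<close> after time \<open>t\<close>.\<close>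

inductive exec :: "com \<Rightarrow> state \<Rightarrow> nat \<Rightarrow> state \<Rightarrow> bool" where
  Skip: "exec Skip s 1 s"
| Assign: "exec (Assign r e) s (exp_cost e + 1) (set_reg r (exp_val e s) s)"
| Store: "exec (Store a e f) s (exp_cost e + exp_cost f + 1)
    (set_cell a (exp_val e s) (exp_val f s) s)"
| Seq: "exec p s t s' \<Longrightarrow> exec q s' t' s'' \<Longrightarrow> exec (Seq p q) s (t + t') s''"
| IfTrue: "test_val b s \<Longrightarrow> exec p s t s' \<Longrightarrow> exec (If b p q) s (test_cost b + t) s'"
| IfFalse: "\<not> test_val b s \<Longrightarrow> exec q s t s' \<Longrightarrow> exec (If b p q) s (test_cost b + t) s'"
| WhileFalse: "\<not> test_val b s \<Longrightarrow> exec (While b p) s (test_cost b) s"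
| WhileTrue: "test_val b s \<Longrightarrow> exec p s t s' \<Longrightarrow> exec (While b p) s' t' s''
    \<Longrightarrow> exec (While b p) s (test_cost b + t + t') s''"

text \<open>Array 0 holds the input word and array 1 receives the output word; everything else is
  initially zero. Output words are used through a self-delimiting code, so the remainder of array 1
  carries no information.\<close>

definition init_state :: "nat list \<Rightarrow> state" where
  "init_state xs = \<lparr>regs = (\<lambda>_. 0),
     arrs = (\<lambda>a i. if a = 0 \<and> i < length xs then xs ! i else 0)\<rparr>"

definition computes :: "com \<Rightarrow> nat list \<Rightarrow> nat \<Rightarrow> nat list \<Rightarrow> bool" where
  "computes p xs t ys \<longleftrightarrow>
     (\<exists>s. exec p (init_state xs) t s \<and> (\<forall>i < length ys. arrs s 1 i = ys ! i))"

fun enc_node :: "node \<Rightarrow> nat list" where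
  "enc_node (Leaf (Cst False)) = [0, 0, 0]"
| "enc_node (Leaf (Cst True)) = [1, 0, 0]"
| "enc_node (Leaf (Lit (Pos v))) = [2, v, 0]"
| "enc_node (Leaf (Lit (Neg v))) = [3, v, 0]"
| "enc_node (AndN a b) = [4, a, b]"
| "enc_node (OrN a b) = [5, a, b]"

definition enc_list :: "('a \<Rightarrow> nat list) \<Rightarrow> 'a list \<Rightarrow> nat list" where
  "enc_list f xs = length xs # concat (map f xs)"

definition enc_nats :: "nat list \<Rightarrow> nat list" where
  "enc_nats = enc_list (\<lambda>x. [x])"

definition enc_circuit :: "circuit \<Rightarrow> nat list" where
  "enc_circuit G = croot G # enc_list enc_node (nodes G)"

text \<open>Each set of leaves is presented by a list of its elements.\<close>

definition enc_input :: "circuit \<Rightarrow> nat list list \<Rightarrow> nat list \<Rightarrow> nat list \<Rightarrow> nat list" where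
  "enc_input G Ls X I = enc_circuit G @ enc_list enc_nats Ls @ enc_nats X @ enc_nats I"

definition enc_output :: "circuit list \<Rightarrow> nat list" where
  "enc_output = enc_list enc_circuit"

end

theory Submission
  imports Defs
begin

text \<open>
  Let \<open>G\<^sub>j\<close> be \<open>G\<close> with the leaves of the first \<open>j\<close> sets relabeled by \<open>\<top>\<close>. Start with all outputs false
  and go down from \<open>j = k\<close> to \<open>1\<close>, where the literal \<open>l\<close> of the \<open>j\<close>th set is made true whenever the
  current assignment \<open>\<tau>\<close> falsifies \<open>G\<^bsub>j-1\<^esub>\<close>. If \<open>\<tau>\<close> satisfies \<open>G\<^sub>j\<close> but not \<open>G\<^bsub>j-1\<^esub>\<close>, then \<open>l\<close> is false under
  \<open>\<tau>\<close>, so the function of \<open>w, w'\<close> in the definition of realizability is true at \<open>(\<top>, \<top>)\<close> and false at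
  \<open>(\<bottom>, \<top>)\<close> and \<open>(\<bottom>, \<bottom>)\<close>; as it is not the conjunction, it is true at \<open>(\<top>, \<bottom>)\<close>, and by monotonicity
  the repaired assignment satisfies \<open>G\<^bsub>j-1\<^esub>\<close>. Since \<open>G\<^sub>k\<close> does not depend on the outputs and is implied by \<open>G\<close>,
  the final assignment satisfies \<open>G\<close> whenever possible.

  As a circuit, each level needs one copy of \<open>G\<^bsub>j-1\<^esub>\<close> and one of its dual, because negations are only available
  at the leaves. This gives \<open>O(k |G|)\<close> shared nodes, which are written out once for each of the at most \<open>k\<close>
  outputs that are ever repaired; the other outputs are the constant \<open>\<bottom>\<close>.
\<close>

section \<open>Evaluating circuits\<close>

text \<open>The bound carries the extra term \<open>card (set X - circuit_vars G)\<close> because an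
  output that does not occur in \<open>G\<close> still needs a circuit with at least one node, and
  neither the number of sets nor the size of \<open>G\<close> accounts for it; the outputs that do
  occur number at most \<open>csize G\<close>. The same recursion appears three times:
  \<open>repaired\<close> acts on assignments, \<open>build\<close> on node lists, and the program
  on arrays. Unrealizability is used only in the first. Two obstacles shape the others. A circuit
  must not contain nodes that its root does not reach, although all outputs share one node list. And
  node numbers need not be topologically sorted, so the semantics of a copy cannot be established in
  list order; it goes through the formulas of the nodes. Negation needs no procedure of its own:
  every output starts with a node for its value and one for the negated value, and each level turns
  such pairs into such pairs.\<close>

lemma node_formula_unique:
  "node_formula G u \<phi> \<Longrightarrow> node_formula G u \<psi> \<Longrightarrow> \<phi> = \<psi>"
proof (induction arbitrary: \<psi> rule: node_formula.induct)
  case (leaf u b)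
  from leaf(3) show ?case by cases (use leaf(2) in simp_all)
next
  case (conj u a b \<phi>1 \<phi>2)
  from conj.prems show ?case
  proof cases
    case c: (conj a' b' \<psi>1 \<psi>2)
    then have "a' = a" "b' = b" using conj.hyps(2) by simp_all
    then show ?thesis using c conj.IH by blast
  qed (use conj.hyps(2) in simp_all)
next
  case (disj u a b \<phi>1 \<phi>2)
  from disj.prems show ?case
  proof cases
    case c: (disj a' b' \<psi>1 \<psi>2)
    then have "a' = a" "b' = b" using disj.hyps(2) by simp_all
    then show ?thesis using c disj.IH by blast
  qed (use disj.hyps(2) in simp_all)
qed

lemma circuit_fun_eq: "node_formula G (croot G) \<phi> \<Longrightarrow> circuit_fun G = sem \<phi>"
  unfolding circuit_fun_def formula_of_def
  by (metis node_formula_unique the_equality)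

text \<open>With an arbitrary numbering the induction needs another order: the edge relation is
  finite and acyclic, so its converse is well-founded.\<close>

lemma wf_circuit_node_formula:
  assumes wf: "wf_circuit G" and u: "u < csize G"
  shows "\<exists>\<phi>. node_formula G u \<phi>"
proof -
  have "edges G \<subseteq> {..<csize G} \<times> {..<csize G}"
    using wf unfolding wf_circuit_def edges_def by auto
  then have "finite (edges G)" by (rule finite_subset) simp
  moreover have "acyclic (edges G)" using wf by (simp add: wf_circuit_def)
  ultimately have "wfP (\<lambda>v u. (u, v) \<in> edges G)"
    using finite_acyclic_wf_converse unfolding wfp_def converse_unfold by blast
  then show ?thesis using u
  proof (induction u rule: wfp_induct_rule)
    case (less u)
    have ch: "\<exists>\<phi>. node_formula G v \<phi>" if "v \<in> children (nodes G ! u)" for v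
    proof -
      have "v < csize G" using that less.prems wf unfolding wf_circuit_def by auto
      moreover have "(u, v) \<in> edges G" using that less.prems unfolding edges_def by auto
      ultimately show ?thesis using less.IH by blast
    qed
    show ?case
    proof (cases "nodes G ! u")
      case (Leaf b) then show ?thesis using node_formula.leaf less.prems by blast
    next
      case (AndN a b) then show ?thesis using ch node_formula.conj less.prems
        by (metis children.simps(2) insertCI)
    next
      case (OrN a b) then show ?thesis using ch node_formula.disj less.prems
        by (metis children.simps(3) insertCI)
    qed
  qed
qed

lemma wf_circuit_root_formula:
  assumes "wf_circuit G" obtains \<phi> where "node_formula G (croot G) \<phi>" "circuit_fun G = sem \<phi>"
proof -
  have "croot G < csize G" using assms unfolding wf_circuit_def by simp
  then obtain \<phi> where "node_formula G (croot G) \<phi>" using wf_circuit_node_formula[OF assms] by blast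
  then show ?thesis using that circuit_fun_eq by simp
qed

section \<open>Circuits that differ only in leaf labels, and monotonicity\<close>

definition same_shape :: "circuit \<Rightarrow> circuit \<Rightarrow> bool" where
  "same_shape G H \<longleftrightarrow> csize G = csize H \<and> croot G = croot H \<and>
     (\<forall>u < csize G. nodes G ! u = nodes H ! u \<or> (\<exists>b c. nodes G ! u = Leaf b \<and> nodes H ! u = Leaf c))"

lemma same_shape_refl: "same_shape G G"
  unfolding same_shape_def by simp

lemma same_shape_sym:
  assumes "same_shape G H" shows "same_shape H G"
  using assms unfolding same_shape_def by (metis (no_types))

lemma same_shape_trans:
  assumes "same_shape G H" "same_shape H K" shows "same_shape G K"
proof -
  have "nodes G ! u = nodes K ! u \<or> (\<exists>b c. nodes G ! u = Leaf b \<and> nodes K ! u = Leaf c)"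
    if "u < csize G" for u
  proof -
    have 1: "nodes G ! u = nodes H ! u \<or> (\<exists>b c. nodes G ! u = Leaf b \<and> nodes H ! u = Leaf c)"
      and 2: "nodes H ! u = nodes K ! u \<or> (\<exists>b c. nodes H ! u = Leaf b \<and> nodes K ! u = Leaf c)"
      using assms that unfolding same_shape_def by simp_all
    show ?thesis using 1 2 by (elim disjE exE conjE) simp_all
  qed
  then show ?thesis using assms unfolding same_shape_def by simp
qed

lemma csize_relabel [simp]: "csize (relabel G L b) = csize G"
  by (simp add: relabel_def csize_def)

lemma croot_relabel [simp]: "croot (relabel G L b) = croot G"
  by (simp add: relabel_def)

lemma nodes_relabel [simp]:
  "u < csize G \<Longrightarrow> nodes (relabel G L b) ! u = (if u \<in> L then Leaf b else nodes G ! u)"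
  by (simp add: relabel_def)

lemma lit_leaves_same_shape:
  assumes "L \<subseteq> lit_leaves H l" "same_shape G H"
  shows "same_shape G (relabel H L b)"
proof (rule same_shape_trans[OF assms(2)])
  show "same_shape H (relabel H L b)"
    using assms(1) unfolding same_shape_def lit_leaves_def by auto
qed

text \<open>Labels and assignment may both change between the two sides: the test circuits for
  realizability use fresh variables \<open>w\<close> and \<open>w'\<close>, which the original
  leaves do not mention.\<close>

definition leaves_le :: "circuit \<Rightarrow> (nat \<Rightarrow> bool) \<Rightarrow> circuit \<Rightarrow> (nat \<Rightarrow> bool) \<Rightarrow> bool" where
  "leaves_le G \<sigma> H \<tau> \<longleftrightarrow> (\<forall>u b c. u < csize G \<longrightarrow> nodes G ! u = Leaf b \<longrightarrow> nodes H ! u = Leaf c \<longrightarrow>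
      label_val b \<sigma> \<longrightarrow> label_val c \<tau>)"

text \<open>Negations occur only at leaves, so implications between corresponding leaves propagate
  upwards. The formula of \<open>H\<close> is fixed before the assignments, so the lemma also yields
  that \<open>H\<close> has a formula.\<close>

lemma same_shape_node_formula:
  assumes "same_shape G H" and "node_formula G u \<phi>"
  shows "\<exists>\<psi>. node_formula H u \<psi> \<and> (\<forall>\<sigma> \<tau>. leaves_le G \<sigma> H \<tau> \<longrightarrow> sem \<phi> \<sigma> \<longrightarrow> sem \<psi> \<tau>)"
  using assms(2)
proof (induction rule: node_formula.induct)
  case (leaf u b)
  then obtain c where c: "nodes H ! u = Leaf c" "u < csize H"
    using assms(1) unfolding same_shape_def by auto
  then have "node_formula H u (FLeaf c)" by (rule node_formula.leaf[rotated])
  then show ?case using leaf c unfolding leaves_le_def by fastforce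
next
  case (conj u a b \<phi>1 \<phi>2)
  then have u: "nodes H ! u = AndN a b" "u < csize H"
    using assms(1) unfolding same_shape_def by (metis node.distinct(1), metis)
  from conj.IH obtain \<psi>1 \<psi>2 where \<psi>: "node_formula H a \<psi>1" "node_formula H b \<psi>2"
    "\<forall>\<sigma> \<tau>. leaves_le G \<sigma> H \<tau> \<longrightarrow> sem \<phi>1 \<sigma> \<longrightarrow> sem \<psi>1 \<tau>"
    "\<forall>\<sigma> \<tau>. leaves_le G \<sigma> H \<tau> \<longrightarrow> sem \<phi>2 \<sigma> \<longrightarrow> sem \<psi>2 \<tau>" by blast
  show ?case
    by (rule exI[of _ "FAnd \<psi>1 \<psi>2"]) (use \<psi> node_formula.conj[OF u(2,1)] in auto)
next
  case (disj u a b \<phi>1 \<phi>2)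
  then have u: "nodes H ! u = OrN a b" "u < csize H"
    using assms(1) unfolding same_shape_def by (metis node.distinct(3), metis)
  from disj.IH obtain \<psi>1 \<psi>2 where \<psi>: "node_formula H a \<psi>1" "node_formula H b \<psi>2"
    "\<forall>\<sigma> \<tau>. leaves_le G \<sigma> H \<tau> \<longrightarrow> sem \<phi>1 \<sigma> \<longrightarrow> sem \<psi>1 \<tau>"
    "\<forall>\<sigma> \<tau>. leaves_le G \<sigma> H \<tau> \<longrightarrow> sem \<phi>2 \<sigma> \<longrightarrow> sem \<psi>2 \<tau>" by blast
  show ?case
    by (rule exI[of _ "FOr \<psi>1 \<psi>2"]) (use \<psi> node_formula.disj[OF u(2,1)] in auto)
qed

lemma same_shape_formula:
  assumes "same_shape G H" "wf_circuit G"
  obtains \<phi> where "node_formula H (croot H) \<phi>" "circuit_fun H = sem \<phi>"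
proof -
  obtain \<phi> where "node_formula G (croot G) \<phi>" using wf_circuit_root_formula assms(2) by blast
  from same_shape_node_formula[OF assms(1) this] obtain \<psi> where "node_formula H (croot H) \<psi>"
    using assms(1) unfolding same_shape_def by auto
  then show ?thesis using that circuit_fun_eq by blast
qed

text \<open>Only the reference circuit \<open>C\<close> is assumed well-formed; relabeled versions
  get their formulas from it through \<open>same_shape\<close>.\<close>

lemma same_shape_mono:
  assumes "same_shape C G" "same_shape C H" "wf_circuit C"
    and leaf: "leaves_le G \<sigma> H \<tau>"
    and sat: "circuit_fun G \<sigma>"
  shows "circuit_fun H \<tau>"
proof -
  have GH: "same_shape G H" using assms same_shape_sym same_shape_trans by blast
  obtain \<phi> where \<phi>: "node_formula G (croot G) \<phi>" "circuit_fun G = sem \<phi>"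
    using same_shape_formula assms by blast
  obtain \<psi> where \<psi>: "node_formula H (croot G) \<psi>" "sem \<phi> \<sigma> \<longrightarrow> sem \<psi> \<tau>"
    using same_shape_node_formula[OF GH \<phi>(1)] leaf by blast
  have "croot G = croot H" using GH unfolding same_shape_def by simp
  then have "circuit_fun H = sem \<psi>" using \<psi>(1) circuit_fun_eq by simp
  then show ?thesis using \<phi>(2) \<psi>(2) sat by simp
qed

section \<open>The repair step\<close>

fun set_true :: "literal \<Rightarrow> (nat \<Rightarrow> bool) \<Rightarrow> nat \<Rightarrow> bool" where
  "set_true (Pos v) \<tau> = \<tau>(v := True)"
| "set_true (Neg v) \<tau> = \<tau>(v := False)"

lemma set_true_other: "v \<noteq> lit_var l \<Longrightarrow> set_true l \<tau> v = \<tau> v"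
  by (cases l) auto

lemma lit_val_set_true:
  "lit_val l' (set_true l \<tau>) =
    (if l' = l then True else if l' = lit_neg l then False else lit_val l' \<tau>)"
  by (cases l; cases l') auto

lemma lit_val_lit_neg [simp]: "lit_val (lit_neg l) \<tau> = (\<not> lit_val l \<tau>)"
  by (cases l) auto

lemma lit_neg_neq [simp]: "lit_neg l \<noteq> l" "l \<noteq> lit_neg l"
  by (cases l; simp)+

lemma lit_var_lit_neg [simp]: "lit_var (lit_neg l) = lit_var l"
  by (cases l) auto

lemma lit_val_cong: "\<tau> (lit_var l) = \<tau>' (lit_var l) \<Longrightarrow> lit_val l \<tau> = lit_val l \<tau>'"
  by (cases l) auto

text \<open>The assignment \<open>\<tau>\<close> itself serves as \<open>\<sigma>\<close> in the
  definition of realizability. If the repair failed, leafwise comparison with \<open>G\<close> would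
  show that \<open>H\<close> computes exactly the conjunction of \<open>w\<close> and
  \<open>w'\<close>.\<close>

lemma and_unrealizable_repair:
  assumes wf: "wf_circuit C" and shape: "same_shape C G" and V: "finite V" "circuit_vars G \<subseteq> V"
    and L: "L \<subseteq> lit_leaves G l" and unreal: "\<not> and_realizable_set V G L"
    and sat: "circuit_fun (relabel G L (Cst True)) \<tau>" and unsat: "\<not> circuit_fun G \<tau>"
  shows "circuit_fun G (set_true l \<tau>)"
proof (rule ccontr)
  assume contra: "\<not> circuit_fun G (set_true l \<tau>)"
  \<comment> \<open>A strict upper bound of the finite set \<open>V\<close> gives two fresh
    variables, itself and its successor.\<close>
  obtain w where m: "\<And>v. v \<in> V \<Longrightarrow> v < w" using V(1) finite_nat_set_iff_bounded by meson
  define w' where "w' = Suc w"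
  have w: "w \<notin> V" and w': "w' \<notin> insert w V" using m unfolding w'_def by fastforce+
  define K where "K = relabel G (lit_leaves G l - L) (Cst False)"
  define H where "H = relabel_pair K l w w'"
  have shapeG: "same_shape C (relabel G L (Cst True))"
    using lit_leaves_same_shape L shape by blast
  have shapeK: "same_shape C K"
    unfolding K_def using lit_leaves_same_shape[OF _ shape] by blast
  have neg: "lit_leaves K (lit_neg l) \<subseteq> lit_leaves (relabel K (lit_leaves K l) (Lit (Pos w))) (lit_neg l)"
    by (auto simp: lit_leaves_def)
  have shapeH: "same_shape C H"
    unfolding H_def relabel_pair_def
    by (rule lit_leaves_same_shape[OF neg lit_leaves_same_shape[OF subset_refl shapeK]])
  have sizeH: "csize H = csize G" unfolding H_def relabel_pair_def K_def by simp
  have fresh: "lit_var l' \<noteq> w \<and> lit_var l' \<noteq> w'" if "nodes G ! u = Leaf (Lit l')" "u < csize G" for u l'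
  proof -
    have "Leaf (Lit l') \<in> set (nodes G)" using that nth_mem unfolding csize_def by metis
    then have "lit_var l' \<in> circuit_vars G" unfolding circuit_vars_def by blast
    then show ?thesis using V(2) w w' by auto
  qed
  \<comment> \<open>Leaf table of \<open>H\<close>: \<open>l\<close>-leaves carry \<open>x\<close>
    inside \<open>L\<close> and are false outside, leaves of the opposite literal carry
    \<open>y\<close>, and freshness keeps all others at their value under
    \<open>\<tau>\<close>.\<close>
  have leafH: "label_val c (\<tau>(w := x, w' := y)) = (case b of Cst d \<Rightarrow> d | Lit l' \<Rightarrow>
      if l' = l then u \<in> L \<and> x else if l' = lit_neg l then y else lit_val l' \<tau>)"
    if u: "u < csize G" "nodes G ! u = Leaf b" "nodes H ! u = Leaf c" for u b c x y
  proof (cases b)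
    case (Cst d)
    then have "nodes H ! u = Leaf b"
      using u L unfolding H_def relabel_pair_def K_def by (auto simp: lit_leaves_def)
    then show ?thesis using Cst u by simp
  next
    case (Lit l')
    have K: "nodes K ! u = (if l' = l \<and> u \<notin> L then Leaf (Cst False) else nodes G ! u)"
      and sizeK: "csize K = csize G"
      using u Lit unfolding K_def by (auto simp: lit_leaves_def)
    have "nodes H ! u = (if l' = l then (if u \<in> L then Leaf (Lit (Pos w)) else Leaf (Cst False))
        else if l' = lit_neg l then Leaf (Lit (Pos w')) else nodes G ! u)"
      using u(1,2) Lit K sizeK unfolding H_def relabel_pair_def lit_leaves_def
      by (cases "l' = l"; cases "u \<in> L") simp_all
    moreover have "lit_val l' (\<tau>(w := x, w' := y)) = lit_val l' \<tau>"
      using fresh u Lit by (intro lit_val_cong) simp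
    ultimately show ?thesis using Lit u w' by (auto split: if_splits)
  qed
  have inL: "nodes G ! u = Leaf (Lit l)" if "u \<in> L" for u
    using that L unfolding lit_leaves_def by auto
  \<comment> \<open>Were \<open>l\<close> true under \<open>\<tau>\<close>, forcing \<open>L\<close>
    to true would change nothing, and \<open>sat\<close> would contradict
    \<open>unsat\<close>.\<close>
  have ltau: "\<not> lit_val l \<tau>"
  proof
    assume l: "lit_val l \<tau>"
    have "leaves_le (relabel G L (Cst True)) \<tau> G \<tau>"
      unfolding leaves_le_def using inL l by (auto split: if_splits)
    then have "circuit_fun G \<tau>" using same_shape_mono[OF shapeG shape wf _ sat] by blast
    with unsat show False by simp
  qed
  have 1: "circuit_fun H (\<tau>(w := True, w' := True))"
  proof (rule same_shape_mono[OF shapeG shapeH wf _ sat], unfold leaves_le_def, intro allI impI)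
    fix u b c
    assume u: "u < csize (relabel G L (Cst True))" "nodes (relabel G L (Cst True)) ! u = Leaf b"
      "nodes H ! u = Leaf c" and b: "label_val b \<tau>"
    show "label_val c (\<tau>(w := True, w' := True))"
    proof (cases "u \<in> L")
      case True
      then show ?thesis using leafH[OF _ inL[OF True] u(3)] u(1) by simp
    next
      case False
      then have "nodes G ! u = Leaf b" using u by simp
      from leafH[OF _ this u(3)] show ?thesis using b u(1) ltau by (cases b) auto
    qed
  qed
  \<comment> \<open>With \<open>w\<close> false, no leaf of \<open>H\<close> exceeds its value in
    \<open>G\<close> under \<open>\<tau>\<close>, whatever \<open>y\<close> is, because the opposite
    literal is true there.\<close>
  have 2: "\<not> circuit_fun H (\<tau>(w := False, w' := y))" for y
  proof
    assume H: "circuit_fun H (\<tau>(w := False, w' := y))"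
    have "circuit_fun G \<tau>"
    proof (rule same_shape_mono[OF shapeH shape wf _ H], unfold leaves_le_def, intro allI impI)
      fix u b c
      assume u: "u < csize H" "nodes H ! u = Leaf c" "nodes G ! u = Leaf b"
        and c: "label_val c (\<tau>(w := False, w' := y))"
      show "label_val b \<tau>"
        using leafH[OF _ u(3,2)] u(1) c ltau sizeH by (cases b) (auto split: if_splits)
    qed
    with unsat show False by simp
  qed
  \<comment> \<open>After the repair every \<open>l\<close>-leaf of \<open>G\<close> is true, and
    the opposite leaves are false on both sides.\<close>
  have 3: "\<not> circuit_fun H (\<tau>(w := True, w' := False))"
  proof
    assume H: "circuit_fun H (\<tau>(w := True, w' := False))"
    have "circuit_fun G (set_true l \<tau>)"
    proof (rule same_shape_mono[OF shapeH shape wf _ H], unfold leaves_le_def, intro allI impI)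
      fix u b c
      assume u: "u < csize H" "nodes H ! u = Leaf c" "nodes G ! u = Leaf b"
        and c: "label_val c (\<tau>(w := True, w' := False))"
      show "label_val b (set_true l \<tau>)"
        using leafH[OF _ u(3,2)] u(1) c sizeH
        by (cases b) (auto simp: lit_val_set_true split: if_splits)
    qed
    with contra show False by simp
  qed
  have "and_realizable V K l"
    unfolding and_realizable_def
  proof (intro exI conjI allI)
    show "w \<notin> V" "w' \<notin> V" "w \<noteq> w'" using w w' by auto
    show "circuit_fun (relabel_pair K l w w') (\<tau>(w := b, w' := b')) = (b \<and> b')" for b b'
      unfolding H_def[symmetric] using 1 2 3 by (cases b; cases b') auto
  qed
  then show False using unreal L unfolding and_realizable_set_def K_def by blast
qed

section \<open>Node lists and the functions they compute\<close>

text \<open>A semantics for lists still under construction: it requires no root and no reachability,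
  and appending nodes preserves it.\<close>

inductive gate :: "node list \<Rightarrow> nat \<Rightarrow> ((nat \<Rightarrow> bool) \<Rightarrow> bool) \<Rightarrow> bool" for ns where
  leaf: "u < length ns \<Longrightarrow> ns ! u = Leaf b \<Longrightarrow> gate ns u (label_val b)"
| conj: "u < length ns \<Longrightarrow> ns ! u = AndN a b \<Longrightarrow> gate ns a f \<Longrightarrow> gate ns b g
    \<Longrightarrow> gate ns u (\<lambda>\<sigma>. f \<sigma> \<and> g \<sigma>)"
| disj: "u < length ns \<Longrightarrow> ns ! u = OrN a b \<Longrightarrow> gate ns a f \<Longrightarrow> gate ns b g
    \<Longrightarrow> gate ns u (\<lambda>\<sigma>. f \<sigma> \<or> g \<sigma>)"

lemma gate_less: "gate ns u f \<Longrightarrow> u < length ns"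
  by (erule gate.cases) auto

lemma gate_append: "gate ns u f \<Longrightarrow> gate (ns @ ms) u f"
proof (induction rule: gate.induct)
  case (leaf u b) then show ?case by (intro gate.leaf) (simp_all add: nth_append)
next
  case (conj u a b f g) then show ?case by (intro gate.conj[of u _ a b]) (simp_all add: nth_append)
next
  case (disj u a b f g) then show ?case by (intro gate.disj[of u _ a b]) (simp_all add: nth_append)
qed

lemma gate_node_formula:
  "gate ns u f \<Longrightarrow> \<exists>\<phi>. node_formula (Circuit ns r) u \<phi> \<and> sem \<phi> = f"
proof (induction rule: gate.induct)
  case (leaf u b)
  have "node_formula (Circuit ns r) u (FLeaf b)"
    using leaf by (intro node_formula.leaf) (simp_all add: csize_def)
  moreover have "sem (FLeaf b) = label_val b" by (rule ext) simp
  ultimately show ?case by blast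
next
  case (conj u a b f g)
  then obtain \<phi> \<psi> where "node_formula (Circuit ns r) a \<phi>" "node_formula (Circuit ns r) b \<psi>"
    "sem \<phi> = f" "sem \<psi> = g" by blast
  moreover have "node_formula (Circuit ns r) u (FAnd \<phi> \<psi>)"
    using conj calculation by (intro node_formula.conj[of u _ a b]) (simp_all add: csize_def)
  moreover have "sem (FAnd \<phi> \<psi>) = (\<lambda>\<sigma>. sem \<phi> \<sigma> \<and> sem \<psi> \<sigma>)" by (rule ext) simp
  ultimately show ?case by blast
next
  case (disj u a b f g)
  then obtain \<phi> \<psi> where "node_formula (Circuit ns r) a \<phi>" "node_formula (Circuit ns r) b \<psi>"
    "sem \<phi> = f" "sem \<psi> = g" by blast
  moreover have "node_formula (Circuit ns r) u (FOr \<phi> \<psi>)"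
    using disj calculation by (intro node_formula.disj[of u _ a b]) (simp_all add: csize_def)
  moreover have "sem (FOr \<phi> \<psi>) = (\<lambda>\<sigma>. sem \<phi> \<sigma> \<or> sem \<psi> \<sigma>)" by (rule ext) simp
  ultimately show ?case by blast
qed

lemma gate_circuit_fun: "gate ns r f \<Longrightarrow> circuit_fun (Circuit ns r) = f"
  using gate_node_formula[of ns r f r] circuit_fun_eq[of "Circuit ns r"] by auto

text \<open>A cycle would force the formula of a node to be a proper subformula of itself.\<close>

lemma gates_acyclic:
  assumes "\<And>u. u < length ns \<Longrightarrow> \<exists>f. gate ns u f"
  shows "acyclic (edges (Circuit ns r))"
    and "\<And>u. u < length ns \<Longrightarrow> children (ns ! u) \<subseteq> {..<length ns}"
proof -
  let ?G = "Circuit ns r"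
  define rk where "rk u = size (THE \<phi>. node_formula ?G u \<phi>)" for u
  have rk: "rk u = size \<phi>" if "node_formula ?G u \<phi>" for u \<phi>
    unfolding rk_def using that node_formula_unique by (metis the_equality)
  have ch: "v < length ns \<and> rk v < rk u" if uv: "u < length ns" "v \<in> children (ns ! u)" for u v
  proof -
    obtain \<phi> where \<phi>: "node_formula ?G u \<phi>"
      using assms[OF uv(1)] gate_node_formula by blast
    have less: "w < length ns" if "node_formula ?G w \<psi>" for w \<psi>
      using that by cases (auto simp: csize_def)
    from \<phi> show ?thesis
    proof cases
      case (leaf b) then show ?thesis using uv by simp
    next
      case (conj a b \<phi>1 \<phi>2)
      then have "v = a \<or> v = b" using uv by simp
      then show ?thesis using conj rk[OF conj(4)] rk[OF conj(5)] rk[OF \<phi>] less[OF conj(4)] less[OF conj(5)]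
        by auto
    next
      case (disj a b \<phi>1 \<phi>2)
      then have "v = a \<or> v = b" using uv by simp
      then show ?thesis using disj rk[OF disj(4)] rk[OF disj(5)] rk[OF \<phi>] less[OF disj(4)] less[OF disj(5)]
        by auto
    qed
  qed
  then have "(edges ?G)\<inverse> \<subseteq> measure rk" unfolding edges_def csize_def by auto
  then have "wf ((edges ?G)\<inverse>)" using wf_subset wf_measure by blast
  then show "acyclic (edges ?G)" using wf_acyclic by fastforce
  show "\<And>u. u < length ns \<Longrightarrow> children (ns ! u) \<subseteq> {..<length ns}" using ch by auto
qed

text \<open>The part of \<open>circuit_over\<close> that makes sense without a root. Gates at all
  nodes replace the conditions on the range of children and on cycles
  (\<open>gates_acyclic\<close>); reachability is left to \<open>finished\<close>.\<close>

definition sound_nodes :: "nat set \<Rightarrow> node list \<Rightarrow> bool" where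
  "sound_nodes V ns \<longleftrightarrow> (\<forall>u < length ns. \<exists>f. gate ns u f) \<and> (\<forall>nd \<in> set ns. two_children nd) \<and>
     (\<forall>l. Leaf (Lit l) \<in> set ns \<longrightarrow> lit_var l \<in> V)"

text \<open>The gates of \<open>ms\<close> are required in the extended list only, since appended
  nodes may refer to each other in any order.\<close>

lemma sound_nodes_append:
  assumes "sound_nodes V ns" and "\<And>u. u < length ms \<Longrightarrow> \<exists>f. gate (ns @ ms) (length ns + u) f"
    and "\<forall>nd \<in> set ms. two_children nd" "\<forall>l. Leaf (Lit l) \<in> set ms \<longrightarrow> lit_var l \<in> V"
  shows "sound_nodes V (ns @ ms)"
proof -
  have "\<exists>f. gate (ns @ ms) u f" if "u < length (ns @ ms)" for u
  proof (cases "u < length ns")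
    case True then show ?thesis using assms(1) gate_append unfolding sound_nodes_def by blast
  next
    case False then show ?thesis using assms(2)[of "u - length ns"] that by simp
  qed
  then show ?thesis using assms unfolding sound_nodes_def by auto
qed

section \<open>From unfinished to finished circuits\<close>

text \<open>The construction never needs to find out which nodes are used by a given output: a
  chain of conjunctions starting from the constant \<open>\<bottom>\<close> is disjoined to the root, which makes every
  node reachable without changing the function.\<close>

definition chained :: "node list \<Rightarrow> node list" where
  "chained D = D @ Leaf (Cst False) # map (\<lambda>i. AndN (length D + i) i) [0..<length D]"

definition finished :: "node list \<Rightarrow> nat \<Rightarrow> circuit" where
  "finished D r = Circuit (chained D @ [OrN r (2 * length D)]) (Suc (2 * length D))"

lemma length_chained: "length (chained D) = Suc (2 * length D)"
  unfolding chained_def by simp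

lemma gate_chained:
  assumes "sound_nodes V D" "i \<le> length D"
  shows "gate (chained D) (length D + i) (\<lambda>_. False)"
  using assms(2)
proof (induction i)
  case 0
  have "gate (chained D) (length D) (label_val (Cst False))"
    by (rule gate.leaf) (simp_all add: chained_def)
  moreover have "label_val (Cst False) = (\<lambda>_. False)" by (rule ext) simp
  ultimately show ?case by simp
next
  case (Suc i)
  have "\<exists>f. gate (chained D) i f"
    using assms Suc unfolding sound_nodes_def chained_def by (meson Suc_le_lessD gate_append)
  then obtain f where f: "gate (chained D) i f" by blast
  have "gate (chained D) (length D + Suc i) (\<lambda>\<sigma>. False \<and> f \<sigma>)"
    by (rule gate.conj[of _ _ "length D + i" i])
      (use Suc f in \<open>auto simp: length_chained\<close>, auto simp: chained_def nth_append)
  then show ?case by simp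
qed

lemma finished_correct:
  assumes D: "sound_nodes V D" and r: "gate D r f" 
  shows "circuit_over V (finished D r)" and "circuit_fun (finished D r) = f"
    and "csize (finished D r) = 2 * length D + 2"
proof -
  let ?n = "length D" and ?ns = "chained D @ [OrN r (2 * length D)]" and ?G = "finished D r"
  have rn: "r < ?n" using r gate_less by blast
  have len: "length ?ns = Suc (Suc (2 * ?n))" by (simp add: length_chained)
  have low: "\<exists>f. gate ?ns u f" if "u < ?n" for u
    using that D unfolding sound_nodes_def chained_def by (metis append_assoc gate_append)
  have mid: "gate ?ns (?n + i) (\<lambda>_. False)" if "i \<le> ?n" for i
    using gate_chained[OF D that] by (rule gate_append)
  have "gate ?ns r f" using r unfolding chained_def by (simp add: gate_append)
  moreover have "gate ?ns (2 * ?n) (\<lambda>_. False)" using mid[of ?n] by (simp add: mult_2)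
  ultimately have "gate ?ns (Suc (2 * ?n)) (\<lambda>\<sigma>. f \<sigma> \<or> False)"
    by (intro gate.disj[of _ _ r "2 * ?n"]) (use len in \<open>auto simp: nth_append length_chained\<close>)
  then have root: "gate ?ns (Suc (2 * ?n)) f" by simp
  then show "circuit_fun ?G = f" unfolding finished_def by (rule gate_circuit_fun)
  show size: "csize ?G = 2 * ?n + 2" unfolding finished_def csize_def using len by simp
  have gates: "\<exists>f. gate ?ns u f" if "u < length ?ns" for u
  proof -
    have "u < ?n \<or> u = Suc (2 * ?n) \<or> (\<exists>i \<le> ?n. u = ?n + i)" using that len by presburger
    then show ?thesis using low root mid by blast
  qed
  have nth_mid: "?ns ! (?n + Suc i) = AndN (?n + i) i" if "i < ?n" for i
    using that by (auto simp: chained_def nth_append)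
  have nth_root: "?ns ! Suc (2 * ?n) = OrN r (2 * ?n)" by (simp add: nth_append length_chained)
  have edge_mid: "(?n + Suc i, ?n + i) \<in> edges ?G" "(?n + Suc i, i) \<in> edges ?G" if "i < ?n" for i
    using nth_mid[OF that] that size unfolding edges_def by (simp_all add: finished_def)
  have "(Suc (2 * ?n), 2 * ?n) \<in> edges ?G" "(Suc (2 * ?n), r) \<in> edges ?G"
    using nth_root size unfolding edges_def by (simp_all add: finished_def)
  then have edge_root: "(Suc (2 * ?n), ?n + ?n) \<in> (edges ?G)\<^sup>*" by (simp add: mult_2 r_into_rtrancl)
  \<comment> \<open>The chain is walked downwards from its far end at \<open>2 * length D\<close>,
    so the induction counts the links passed.\<close>
  have reach_mid: "(Suc (2 * ?n), ?n + (?n - i)) \<in> (edges ?G)\<^sup>*" if "i \<le> ?n" for i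
    using that
  proof (induction i)
    case 0 then show ?case using edge_root by simp
  next
    case (Suc i)
    then have "?n - i = Suc (?n - Suc i)" by simp
    then have "(?n + (?n - i), ?n + (?n - Suc i)) \<in> edges ?G"
      using edge_mid(1)[of "?n - Suc i"] Suc.prems by simp
    with Suc show ?case by (meson Suc_leD rtrancl.rtrancl_into_rtrancl)
  qed
  have reach_mid: "(Suc (2 * ?n), ?n + i) \<in> (edges ?G)\<^sup>*" if "i \<le> ?n" for i
    using reach_mid[of "?n - i"] that by simp
  have reach: "(croot ?G, u) \<in> (edges ?G)\<^sup>*" if "u < csize ?G" for u
  proof -
    have "u < ?n \<or> u = Suc (2 * ?n) \<or> (\<exists>i \<le> ?n. u = ?n + i)" using that size by presburger
    \<comment> \<open>Node \<open>u\<close> of \<open>D\<close> is the second child of the link at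
      \<open>length D + Suc u\<close>.\<close>
    moreover have "(Suc (2 * ?n), u) \<in> (edges ?G)\<^sup>*" if "u < ?n"
      using reach_mid[of "Suc u"] edge_mid(2)[of u] that
      by (meson Suc_leI rtrancl.rtrancl_into_rtrancl)
    ultimately have "(Suc (2 * ?n), u) \<in> (edges ?G)\<^sup>*" using reach_mid by blast
    then show ?thesis by (simp add: finished_def)
  qed
  \<comment> \<open>The children differ since \<open>r\<close> and every \<open>i\<close> are below
    \<open>length D\<close>, where the chain begins.\<close>
  have "\<forall>nd \<in> set ?ns. two_children nd"
    using D rn unfolding sound_nodes_def chained_def by auto
  then have two: "two_children (?ns ! u)" if "u < length ?ns" for u using that nth_mem by blast
  have "circuit_vars ?G \<subseteq> V"
    using D unfolding circuit_vars_def sound_nodes_def finished_def chained_def by auto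
  moreover have "wf_circuit ?G"
    unfolding wf_circuit_def
  proof (intro conjI allI impI)
    show "croot ?G < csize ?G" unfolding size by (simp add: finished_def)
    show "acyclic (edges ?G)" unfolding finished_def using gates_acyclic(1) gates by blast
    fix u assume u: "u < csize ?G"
    then have u': "u < length ?ns" using size len by simp
    show "children (nodes ?G ! u) \<subseteq> {..<csize ?G}"
      using gates_acyclic(2)[OF gates u'] size len by (simp add: finished_def)
    show "two_children (nodes ?G ! u)" using two[OF u'] by (simp add: finished_def)
    show "(croot ?G, u) \<in> (edges ?G)\<^sup>*" using reach u by blast
  qed
  ultimately show "circuit_over V ?G" unfolding circuit_over_def by simp
qed

definition bottom_circuit :: circuit where
  "bottom_circuit = Circuit [Leaf (Cst False)] 0"

lemma bottom_circuit_correct: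
  "circuit_over V bottom_circuit" "circuit_fun bottom_circuit = (\<lambda>_. False)"
  "csize bottom_circuit = 1"
proof -
  have g: "gate [Leaf (Cst False)] 0 (label_val (Cst False))" by (rule gate.leaf) simp_all
  then show "circuit_fun bottom_circuit = (\<lambda>_. False)"
    unfolding bottom_circuit_def using gate_circuit_fun[OF g] by (simp add: fun_eq_iff)
  have "acyclic (edges bottom_circuit)"
    by (simp add: edges_def bottom_circuit_def csize_def acyclic_def cong: conj_cong)
  then show "circuit_over V bottom_circuit"
    unfolding circuit_over_def wf_circuit_def circuit_vars_def
    by (auto simp: bottom_circuit_def csize_def)
  show "csize bottom_circuit = 1" by (simp add: bottom_circuit_def csize_def)
qed

lemma label_val_Cst: "label_val (Cst b) = (\<lambda>_. b)"
  by (rule ext) simp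

lemma label_val_Lit: "label_val (Lit l) = lit_val l"
  by (rule ext) simp

lemma relabel_relabel: "relabel (relabel G A b) B b = relabel G (A \<union> B) b"
  unfolding relabel_def csize_def by (auto intro!: nth_equalityI)

lemma nth_concat_pairs:
  assumes "\<And>x. length (f x) = 2" "u < length xs"
  shows "concat (map f xs) ! (2 * u) = f (xs ! u) ! 0"
    and "concat (map f xs) ! Suc (2 * u) = f (xs ! u) ! 1"
    and "length (concat (map f xs)) = 2 * length xs"
proof -
  show len: "length (concat (map f xs)) = 2 * length xs" for xs
    using assms(1) by (induction xs) auto
  have xs: "xs = take u xs @ xs ! u # drop (Suc u) xs" using assms(2) by (rule id_take_nth_drop)
  have "concat (map f xs) = concat (map f (take u xs)) @ f (xs ! u) @ concat (map f (drop (Suc u) xs))"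
    by (subst xs) (simp only: map_append list.map concat_append concat.simps)
  moreover have "length (concat (map f (take u xs))) = 2 * u"
    using len[of "take u xs"] assms(2) by simp
  ultimately show "concat (map f xs) ! (2 * u) = f (xs ! u) ! 0"
    "concat (map f xs) ! Suc (2 * u) = f (xs ! u) ! 1"
    using assms(1)[of "xs ! u"] by (simp_all add: nth_append)
qed

section \<open>The Skolem functions\<close>

text \<open>Unspecified off literal leaves; in \<open>length_X_le\<close> only an image that covers
  the variables is needed.\<close>

fun leaf_lit :: "node \<Rightarrow> literal" where
  "leaf_lit (Leaf (Lit l)) = l"

text \<open>Node \<open>u\<close> of the source has its copy at position \<open>off + 2 * u\<close> and the dual copy, which
  computes the negation, right after it. A leaf labeled by an output variable becomes an alias of
  the node that currently computes this variable; \<open>N v = 0\<close> marks the variables that are not outputs.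
  Node 2 is a copy of \<open>\<top>\<close> that is never a value of \<open>P\<close> or \<open>N\<close>, hence the two children differ.\<close>

fun copies :: "(nat \<Rightarrow> nat) \<Rightarrow> (nat \<Rightarrow> nat) \<Rightarrow> nat \<Rightarrow> node \<Rightarrow> node list" where
  "copies P N off (Leaf (Cst b)) = [Leaf (Cst b), Leaf (Cst (\<not> b))]"
| "copies P N off (Leaf (Lit (Pos v))) =
    (if N v = 0 then [Leaf (Lit (Pos v)), Leaf (Lit (Neg v))] else [AndN (P v) 2, AndN (N v) 2])"
| "copies P N off (Leaf (Lit (Neg v))) =
    (if N v = 0 then [Leaf (Lit (Neg v)), Leaf (Lit (Pos v))] else [AndN (N v) 2, AndN (P v) 2])"
| "copies P N off (AndN a b) =
    [AndN (off + 2 * a) (off + 2 * b), OrN (Suc (off + 2 * a)) (Suc (off + 2 * b))]"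
| "copies P N off (OrN a b) =
    [OrN (off + 2 * a) (off + 2 * b), AndN (Suc (off + 2 * a)) (Suc (off + 2 * b))]"

text \<open>\<open>r\<close> and \<open>Suc r\<close> are the root of the current copy and its dual.
  For a positive literal the value becomes true where the stage fails; the second node is the De
  Morgan dual, and a negative literal exchanges the roles of \<open>P\<close> and
  \<open>N\<close>.\<close>

fun update_nodes :: "(nat \<Rightarrow> nat) \<Rightarrow> (nat \<Rightarrow> nat) \<Rightarrow> nat \<Rightarrow> literal \<Rightarrow> node list" where
  "update_nodes P N r (Pos v) = [OrN (P v) (Suc r), AndN (N v) r]"
| "update_nodes P N r (Neg v) = [AndN (P v) r, OrN (N v) (Suc r)]"

lemma length_copies: "length (copies P N off nd) = 2"
  by (cases "(P, N, off, nd)" rule: copies.cases) auto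

lemma length_update_nodes: "length (update_nodes P N r l) = 2"
  by (cases l) auto

definition forced :: "nat list list \<Rightarrow> nat \<Rightarrow> nat set" where
  "forced Ls j = (\<Union>i<j. set (Ls ! i))"

locale saunf_instance =
  fixes I X :: "nat list" and G :: circuit and Ls :: "nat list list"
  assumes distinct_X: "distinct X"
    and G_over: "circuit_over (set I \<union> set X) G"
    and distinct_Ls: "\<forall>L \<in> set Ls. distinct L"
    and saunf: "saunf I X G (map set Ls)"
begin

abbreviation "k \<equiv> length Ls"

abbreviation "n \<equiv> csize G"

section \<open>The stages of \<open>G\<close> and the literals of the leaf sets\<close>

definition stage :: "nat \<Rightarrow> circuit" where
  "stage j = relabel G (forced Ls j) (Cst True)"

text \<open>The last leaf is chosen because the scan overwrites the entry in \<open>First\<close>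
  for every leaf of a set. For an empty list the literal is unspecified and no repair takes
  place.\<close>

definition set_lit :: "nat \<Rightarrow> literal" where
  "set_lit j = leaf_lit (nodes G ! last (Ls ! j))"

lemma wf: "wf_circuit G"
  using G_over unfolding circuit_over_def by simp

lemma root_less: "croot G < n"
  using wf unfolding wf_circuit_def by simp

lemma disjoint: "i < k \<Longrightarrow> j < k \<Longrightarrow> i \<noteq> j \<Longrightarrow> set (Ls ! i) \<inter> set (Ls ! j) = {}"
  using saunf unfolding saunf_def by simp

lemma forced_eq: "j \<le> k \<Longrightarrow> (\<Union>i<j. map set Ls ! i) = forced Ls j"
  unfolding forced_def by (intro SUP_cong) auto

lemma forced_all: "\<Union>(set (map set Ls)) = forced Ls k"
proof -
  have "set Ls = (!) Ls ` {..<k}" by (auto simp: in_set_conv_nth)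
  then show ?thesis unfolding forced_def by (simp add: image_image)
qed

lemma set_lit:
  assumes "j < k" "Ls ! j \<noteq> []"
  shows "lit_var (set_lit j) \<in> set X" "set (Ls ! j) \<subseteq> lit_leaves G (set_lit j)"
    "last (Ls ! j) < n" "nodes G ! last (Ls ! j) = Leaf (Lit (set_lit j))"
proof -
  have "set (Ls ! j) \<in> set (map set Ls)" using assms by simp
  then obtain l where l: "lit_var l \<in> set X" "set (Ls ! j) \<subseteq> lit_leaves G l"
    using saunf[unfolded saunf_def, THEN conjunct2, THEN conjunct2, THEN conjunct1] by blast
  have "last (Ls ! j) \<in> lit_leaves G l" using assms l(2) by auto
  then have *: "nodes G ! last (Ls ! j) = Leaf (Lit l)" "last (Ls ! j) < n"
    unfolding lit_leaves_def by auto
  then have "set_lit j = l" unfolding set_lit_def by simp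
  with l * show "lit_var (set_lit j) \<in> set X" "set (Ls ! j) \<subseteq> lit_leaves G (set_lit j)"
    "last (Ls ! j) < n" "nodes G ! last (Ls ! j) = Leaf (Lit (set_lit j))" by simp_all
qed

lemma forced_leaf:
  assumes "j \<le> k" "u \<in> forced Ls j" shows "u < n" "\<exists>l. nodes G ! u = Leaf (Lit l)"
proof -
  obtain i where "i < j" and u: "u \<in> set (Ls ! i)" using assms(2) unfolding forced_def by auto
  with assms(1) have i: "i < k" "u \<in> set (Ls ! i)" by simp_all
  then have "u \<in> lit_leaves G (set_lit i)" using set_lit(2)[of i] by force
  then show "u < n" "\<exists>l. nodes G ! u = Leaf (Lit l)" unfolding lit_leaves_def by auto
qed

lemma stage_shape: "j \<le> k \<Longrightarrow> same_shape G (stage j)"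
proof -
  assume j: "j \<le> k"
  have "\<exists>b. nodes G ! u = Leaf b" if "u \<in> forced Ls j" for u
    using forced_leaf(2)[OF j that] by blast
  then show ?thesis unfolding same_shape_def stage_def by simp
qed

lemma stage_0: "stage 0 = G"
  unfolding stage_def forced_def relabel_def csize_def
  by (cases G) (auto intro!: nth_equalityI)

lemma stage_Suc: "relabel (stage j) (set (Ls ! j)) (Cst True) = stage (Suc j)"
  unfolding stage_def relabel_relabel forced_def lessThan_Suc by (simp add: Un_commute)

lemma stage_vars: "circuit_vars (stage j) \<subseteq> set I \<union> set X"
proof
  fix v assume "v \<in> circuit_vars (stage j)"
  then obtain l where l: "Leaf (Lit l) \<in> set (nodes (stage j))" "v = lit_var l"
    unfolding circuit_vars_def by auto
  then have "Leaf (Lit l) \<in> set (nodes G)"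
    unfolding stage_def relabel_def csize_def by (auto split: if_splits)
  then show "v \<in> set I \<union> set X"
    using G_over l(2) unfolding circuit_over_def circuit_vars_def by blast
qed

lemma stage_mono: "j \<le> k \<Longrightarrow> circuit_fun G \<tau> \<Longrightarrow> circuit_fun (stage j) \<tau>"
  by (rule same_shape_mono[OF same_shape_refl stage_shape wf])
    (auto simp: leaves_le_def stage_def split: if_splits)

text \<open>The index counts the levels treated, so step \<open>Suc i\<close> handles the set with
  index \<open>k - Suc i\<close>. An empty set has no literal to set, and the stages before and
  after it coincide.\<close>

primrec repaired :: "nat \<Rightarrow> (nat \<Rightarrow> bool) \<Rightarrow> nat \<Rightarrow> bool" where
  "repaired 0 \<sigma> = (\<lambda>v. if v \<in> set X then False else \<sigma> v)"
| "repaired (Suc i) \<sigma> =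
    (if Ls ! (k - Suc i) = [] \<or> circuit_fun (stage (k - Suc i)) (repaired i \<sigma>) then repaired i \<sigma>
     else set_true (set_lit (k - Suc i)) (repaired i \<sigma>))"

lemma repaired_input: "i \<le> k \<Longrightarrow> v \<notin> set X \<Longrightarrow> repaired i \<sigma> v = \<sigma> v"
proof (induction i)
  case (Suc i)
  then have "v \<noteq> lit_var (set_lit (k - Suc i))" if "Ls ! (k - Suc i) \<noteq> []"
    using set_lit(1)[of "k - Suc i"] that by force
  then show ?case using Suc set_true_other by simp
qed simp

text \<open>Each step applies \<open>and_unrealizable_repair\<close> to \<open>stage j\<close>,
  whose relabeled version is \<open>stage (Suc j)\<close>.\<close>

lemma stage_repaired:
  assumes "i \<le> k" "circuit_fun (stage k) (repaired 0 \<sigma>)"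
  shows "circuit_fun (stage (k - i)) (repaired i \<sigma>)"
  using assms(1)
proof (induction i)
  case 0 then show ?case using assms(2) by simp
next
  case (Suc i)
  define j where "j = k - Suc i"
  have j: "j < k" "k - i = Suc j" using Suc.prems unfolding j_def by simp_all
  have IH: "circuit_fun (relabel (stage j) (set (Ls ! j)) (Cst True)) (repaired i \<sigma>)"
    using Suc j(2) by (simp add: stage_Suc)
  show ?case
  proof (cases "Ls ! j = [] \<or> circuit_fun (stage j) (repaired i \<sigma>)")
    case True
    have "relabel (stage j) {} (Cst True) = stage j"
      unfolding stage_def relabel_relabel by simp
    then show ?thesis using True IH j_def by auto
  next
    case False
    \<comment> \<open>The leaves of set \<open>j\<close> have not been overwritten by earlier sets,
      so they still carry their literal in \<open>stage j\<close>.\<close>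
    have "set (Ls ! j) \<inter> set (Ls ! i') = {}" if "i' < j" for i'
      using disjoint[of j i'] that j(1) by simp
    then have "set (Ls ! j) \<inter> forced Ls j = {}" unfolding forced_def by blast
    then have L: "set (Ls ! j) \<subseteq> lit_leaves (stage j) (set_lit j)"
      using set_lit(2)[OF j(1)] False unfolding lit_leaves_def stage_def
      by (auto simp: disjoint_iff subset_iff)
    have "\<not> and_realizable_set (set I \<union> set X) (stage j) (set (Ls ! j))"
    proof -
      have "\<forall>j < k. \<not> and_realizable_set (set I \<union> set X)
          (relabel G (\<Union>i<j. map set Ls ! i) (Cst True)) (map set Ls ! j)"
        using saunf unfolding saunf_def by simp
      from this[rule_format, OF j(1)] show ?thesis
        unfolding forced_eq[OF less_imp_le[OF j(1)]] stage_def using j(1) by simp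
    qed
    from and_unrealizable_repair[OF wf stage_shape _ stage_vars L this IH] j(1) False
    show ?thesis by (simp add: j_def)
  qed
qed

lemma repaired_correct:
  "circuit_fun G (repaired k \<sigma>) \<longleftrightarrow> (\<exists>\<tau>. (\<forall>v. v \<notin> set X \<longrightarrow> \<tau> v = \<sigma> v) \<and> circuit_fun G \<tau>)"
proof
  assume "circuit_fun G (repaired k \<sigma>)"
  then show "\<exists>\<tau>. (\<forall>v. v \<notin> set X \<longrightarrow> \<tau> v = \<sigma> v) \<and> circuit_fun G \<tau>"
    using repaired_input by blast
next
  assume "\<exists>\<tau>. (\<forall>v. v \<notin> set X \<longrightarrow> \<tau> v = \<sigma> v) \<and> circuit_fun G \<tau>"
  then obtain \<tau> where \<tau>: "\<forall>v. v \<notin> set X \<longrightarrow> \<tau> v = \<sigma> v" "circuit_fun G \<tau>" by blast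
  have "\<forall>\<sigma> \<tau>. (\<forall>v. v \<notin> set X \<longrightarrow> \<sigma> v = \<tau> v) \<longrightarrow> circuit_fun (stage k) \<sigma> = circuit_fun (stage k) \<tau>"
    using saunf[unfolded saunf_def forced_all, THEN conjunct2, THEN conjunct2, THEN conjunct2,
        THEN conjunct2] unfolding stage_def .
  from this[rule_format, of "repaired 0 \<sigma>" \<tau>]
  have "circuit_fun (stage k) (repaired 0 \<sigma>) = circuit_fun (stage k) \<tau>" using \<tau>(1) by simp
  then have "circuit_fun (stage k) (repaired 0 \<sigma>)" using stage_mono \<tau>(2) by simp
  from stage_repaired[OF _ this, of k] show "circuit_fun G (repaired k \<sigma>)" by (simp add: stage_0)
qed

section \<open>The repair as a growing list of nodes\<close>

definition copied :: "node list \<Rightarrow> (nat \<Rightarrow> nat) \<Rightarrow> (nat \<Rightarrow> nat) \<Rightarrow> nat \<Rightarrow> node list" where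
  "copied D P N j = D @ concat (map (copies P N (length D)) (nodes (stage j)))"

text \<open>The root of the new copy sits at \<open>length D + 2 * croot G\<close>; the two update
  nodes follow the copy, at \<open>length D'\<close> and its successor.\<close>

fun next_level :: "nat \<Rightarrow> node list \<times> (nat \<Rightarrow> nat) \<times> (nat \<Rightarrow> nat) \<Rightarrow>
    node list \<times> (nat \<Rightarrow> nat) \<times> (nat \<Rightarrow> nat)" where
  "next_level j (D, P, N) =
    (let D' = copied D P N j; l = set_lit j in
     if Ls ! j = [] then (D', P, N)
     else (D' @ update_nodes P N (length D + 2 * croot G) l,
           P(lit_var l := length D'), N(lit_var l := Suc (length D'))))"

text \<open>At the start node 0 is the value and node 1 the negated value of every output. Later
  values lie at positions of at least 3, so \<open>P v = 0\<close> continues to say that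
  \<open>v\<close> was never repaired.\<close>

primrec build :: "nat \<Rightarrow> node list \<times> (nat \<Rightarrow> nat) \<times> (nat \<Rightarrow> nat)" where
  "build 0 = ([Leaf (Cst False), Leaf (Cst True), Leaf (Cst True)], \<lambda>_. 0,
     \<lambda>v. if v \<in> set X then 1 else 0)"
| "build (Suc i) = next_level (k - Suc i) (build i)"

lemma length_nodes_stage: "length (nodes (stage j)) = n"
  by (simp add: stage_def relabel_def)

lemma length_copied: "length (copied D P N j) = length D + 2 * n"
proof -
  have "length (concat (map f xs)) = 2 * length xs" if "\<And>x. length (f x) = 2"
    for f :: "node \<Rightarrow> node list" and xs
    using that by (induction xs) auto
  then show ?thesis unfolding copied_def by (simp add: length_copies length_nodes_stage)
qed

lemma nth_copied:
  assumes "u < n"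
  shows "copied D P N j ! (length D + 2 * u) = copies P N (length D) (nodes (stage j) ! u) ! 0"
    and "copied D P N j ! Suc (length D + 2 * u) = copies P N (length D) (nodes (stage j) ! u) ! 1"
  using nth_concat_pairs[of "copies P N (length D)", OF length_copies, of u "nodes (stage j)"] assms
  unfolding copied_def length_nodes_stage by (simp_all add: nth_append)

text \<open>The leaves are over \<open>set I\<close> because outputs have been substituted away. The
  inequalities keep the children of alias nodes distinct and reserve \<open>N v = 0\<close> for
  variables that are not outputs.\<close>

definition built :: "nat \<Rightarrow> node list \<Rightarrow> (nat \<Rightarrow> nat) \<Rightarrow> (nat \<Rightarrow> nat) \<Rightarrow> bool" where
  "built i D P N \<longleftrightarrow> sound_nodes (set I) D \<and> 3 \<le> length D \<and>
     D ! 0 = Leaf (Cst False) \<and> D ! 2 = Leaf (Cst True) \<and>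
     (\<forall>v \<in> set X. gate D (P v) (\<lambda>\<sigma>. repaired i \<sigma> v) \<and> gate D (N v) (\<lambda>\<sigma>. \<not> repaired i \<sigma> v) \<and>
        P v \<noteq> 2 \<and> N v \<noteq> 2 \<and> N v \<noteq> 0) \<and>
     (\<forall>v. v \<notin> set X \<longrightarrow> N v = 0)"

lemma gate_true_conj: "gate D a f \<Longrightarrow> 3 \<le> length D \<Longrightarrow> D ! 2 = Leaf (Cst True) \<Longrightarrow>
    u < length D \<Longrightarrow> D ! u = AndN a 2 \<Longrightarrow> gate D u f"
  using gate.conj[of u D a 2 f "label_val (Cst True)"] gate.leaf[of 2 D "Cst True"]
  by simp

text \<open>The copy is the stage with the current repaired values substituted for the outputs:
  aliases supply these at the leaves, and the dual copy exchanges conjunction and disjunction by De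
  Morgan.\<close>

lemma gate_copied:
  assumes inv: "built i D P N" and i: "i \<le> k" and j: "j \<le> k"
    and u: "node_formula (stage j) u \<phi>"
  shows "gate (copied D P N j) (length D + 2 * u) (\<lambda>\<sigma>. sem \<phi> (repaired i \<sigma>)) \<and>
    gate (copied D P N j) (Suc (length D + 2 * u)) (\<lambda>\<sigma>. \<not> sem \<phi> (repaired i \<sigma>))"
  using u
proof (induction rule: node_formula.induct)
  let ?D = "copied D P N j"
  have lenD: "length ?D = length D + 2 * n" by (rule length_copied)
  case (leaf u b)
  have u: "u < n" using leaf by (simp add: stage_def)
  then have uD: "length D + 2 * u < length ?D" "Suc (length D + 2 * u) < length ?D"
    using lenD by simp_all
  note nth = nth_copied[OF u, of D P N j, unfolded leaf(2)]
  show ?case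
  proof (cases b)
    case (Cst x)
    have "gate ?D (length D + 2 * u) (label_val (Cst x))"
      "gate ?D (Suc (length D + 2 * u)) (label_val (Cst (\<not> x)))"
      using nth uD Cst by (auto intro!: gate.leaf)
    then show ?thesis using Cst by (simp add: label_val_Cst)
  next
    case (Lit l)
    define v where "v = lit_var l"
    show ?thesis
    proof (cases "v \<in> set X")
      case False
      have N0: "N v = 0" using False inv unfolding built_def by blast
      have val: "label_val b (repaired i \<sigma>) = lit_val l \<sigma>" for \<sigma>
      proof -
        have "lit_val l (repaired i \<sigma>) = lit_val l \<sigma>"
          using repaired_input[OF i False] unfolding v_def by (rule lit_val_cong)
        then show ?thesis using Lit by simp
      qed
      have "gate ?D (length D + 2 * u) (label_val (Lit l))"
        "gate ?D (Suc (length D + 2 * u)) (label_val (Lit (lit_neg l)))"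
        using nth uD Lit N0 unfolding v_def by (cases l; auto intro!: gate.leaf)+
      moreover have "lit_val (lit_neg l) = (\<lambda>\<sigma>. \<not> lit_val l \<sigma>)" by (rule ext) simp
      ultimately show ?thesis using val by (simp add: label_val_Lit)
    next
      case True
      then have PN: "gate ?D (P v) (\<lambda>\<sigma>. repaired i \<sigma> v)" "gate ?D (N v) (\<lambda>\<sigma>. \<not> repaired i \<sigma> v)"
        "N v \<noteq> 0"
        using inv gate_append unfolding built_def copied_def by blast+
      have D3: "3 \<le> length ?D" "?D ! 2 = Leaf (Cst True)"
        using inv unfolding built_def by (simp_all add: copied_def nth_append)
      show ?thesis
      proof (cases l)
        case (Pos w)
        then have "w = v" unfolding v_def by simp
        then show ?thesis
          using gate_true_conj[OF PN(1) D3 uD(1)] gate_true_conj[OF PN(2) D3 uD(2)] nth Lit Pos PN(3)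
          by simp
      next
        case (Neg w)
        then have "w = v" unfolding v_def by simp
        then show ?thesis
          using gate_true_conj[OF PN(2) D3 uD(1)] gate_true_conj[OF PN(1) D3 uD(2)] nth Lit Neg PN(3)
          by simp
      qed
    qed
  qed
next
  let ?D = "copied D P N j"
  have lenD: "length ?D = length D + 2 * n" by (rule length_copied)
  case (conj u a b \<phi> \<psi>)
  have u: "u < n" using conj by (simp add: stage_def)
  then have uD: "length D + 2 * u < length ?D" "Suc (length D + 2 * u) < length ?D"
    using lenD by simp_all
  note nth = nth_copied[OF u, of D P N j, unfolded conj(2)]
  show ?case
    using gate.conj[OF uD(1) _ conj.IH(1)[THEN conjunct1] conj.IH(2)[THEN conjunct1]]
      gate.disj[OF uD(2) _ conj.IH(1)[THEN conjunct2] conj.IH(2)[THEN conjunct2]] nth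
    by simp
next
  let ?D = "copied D P N j"
  have lenD: "length ?D = length D + 2 * n" by (rule length_copied)
  case (disj u a b \<phi> \<psi>)
  have u: "u < n" using disj by (simp add: stage_def)
  then have uD: "length D + 2 * u < length ?D" "Suc (length D + 2 * u) < length ?D"
    using lenD by simp_all
  note nth = nth_copied[OF u, of D P N j, unfolded disj(2)]
  show ?case
    using gate.disj[OF uD(1) _ disj.IH(1)[THEN conjunct1] disj.IH(2)[THEN conjunct1]]
      gate.conj[OF uD(2) _ disj.IH(1)[THEN conjunct2] disj.IH(2)[THEN conjunct2]] nth
    by simp
qed

lemma sound_copied:
  assumes inv: "built i D P N" and i: "i \<le> k" and j: "j \<le> k"
  shows "sound_nodes (set I) (copied D P N j)"
  unfolding copied_def
proof (rule sound_nodes_append; (unfold copied_def[symmetric])?)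
  show "sound_nodes (set I) D" using inv unfolding built_def by simp
  let ?ms = "concat (map (copies P N (length D)) (nodes (stage j)))"
  have len: "length ?ms = 2 * n" using length_copied[of D P N j] unfolding copied_def by simp
  show "\<exists>f. gate (copied D P N j) (length D + u) f" if u: "u < length ?ms" for u
  proof -
    have u2: "u div 2 < n" using u len by simp
    obtain \<phi> where "node_formula G (u div 2) \<phi>" using wf_circuit_node_formula[OF wf u2] by blast
    then obtain \<psi> where \<psi>: "node_formula (stage j) (u div 2) \<psi>"
      using same_shape_node_formula[OF stage_shape[OF j]] by blast
    \<comment> \<open>Even offsets are the copies, odd offsets the duals.\<close>
    have "u = 2 * (u div 2) \<or> u = Suc (2 * (u div 2))" by presburger
    then show ?thesis using gate_copied[OF inv i j \<psi>] by (metis add_Suc_right)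
  qed
  have node: "two_children nd \<and> (\<forall>l. nd = Leaf (Lit l) \<longrightarrow> lit_var l \<in> set I)"
    if nd: "nd \<in> set (copies P N (length D) src)" and src: "src \<in> set (nodes (stage j))" for nd src
  proof -
    have two: "two_children src"
    proof -
      obtain u where u: "u < n" "src = nodes (stage j) ! u"
        using src unfolding in_set_conv_nth length_nodes_stage by auto
      have "two_children (nodes G ! u)" using wf u(1) unfolding wf_circuit_def by simp
      then show ?thesis using u unfolding stage_def by simp
    qed
    have PN: "P v \<noteq> 2" "N v \<noteq> 2" if "N v \<noteq> 0" for v
      using inv that unfolding built_def by metis+
    \<comment> \<open>A literal is kept only where \<open>N v = 0\<close>, hence off
      \<open>set X\<close>, and every variable of a stage is an input or an output.\<close>
    have I: "v \<in> set I" if "src = Leaf (Lit l)" "v = lit_var l" "N v = 0" for l v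
    proof -
      have "v \<in> circuit_vars (stage j)"
        using that src unfolding circuit_vars_def by blast
      moreover have "v \<notin> set X" using inv that unfolding built_def by blast
      ultimately show ?thesis using stage_vars by blast
    qed
    show ?thesis
    proof (cases src)
      case (Leaf b)
      then show ?thesis
      proof (cases b)
        case (Lit l)
        then show ?thesis using nd Leaf I[of l] PN[of "lit_var l"]
          by (cases l) (auto split: if_splits)
      qed (use nd Leaf in auto)
    qed (use nd two in auto)
  qed
  show "\<forall>nd \<in> set ?ms. two_children nd" using node by fastforce
  show "\<forall>l. Leaf (Lit l) \<in> set ?ms \<longrightarrow> lit_var l \<in> set I" using node by fastforce
qed

lemma built_next_level:
  assumes inv: "built i D P N" and i: "i < k"
    and eq: "next_level (k - Suc i) (D, P, N) = (D', P', N')"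
  shows "built (Suc i) D' P' N'"
proof -
  define j where "j = k - Suc i"
  define C where "C = copied D P N j"
  define r where "r = length D + 2 * croot G"
  have j: "j < k" using i unfolding j_def by simp
  have soundC: "sound_nodes (set I) C"
    unfolding C_def using sound_copied[OF inv] i j by simp
  have lenC: "length C = length D + 2 * n" unfolding C_def by (rule length_copied)
  have invC: "built i C P N"
    using inv soundC gate_append[of D] unfolding built_def C_def copied_def by (auto simp: nth_append)
  obtain \<phi> where \<phi>: "node_formula (stage j) (croot G) \<phi>" "circuit_fun (stage j) = sem \<phi>"
    using same_shape_formula[OF stage_shape wf] j by (metis croot_relabel less_imp_le stage_def)
  have root: "gate C r (\<lambda>\<sigma>. circuit_fun (stage j) (repaired i \<sigma>))"
    "gate C (Suc r) (\<lambda>\<sigma>. \<not> circuit_fun (stage j) (repaired i \<sigma>))"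
    using gate_copied[OF inv _ _ \<phi>(1)] i j \<phi>(2) unfolding r_def C_def by simp_all
  show ?thesis
  proof (cases "Ls ! j = []")
    case True
    then have "D' = C" "P' = P" "N' = N" using eq by (auto simp: Let_def C_def j_def)
    then show ?thesis using invC True unfolding built_def by (simp add: j_def)
  next
    case False
    define l where "l = set_lit j"
    define v where "v = lit_var l"
    have v: "v \<in> set X" using set_lit(1)[OF j False] unfolding v_def l_def .
    have new: "D' = C @ update_nodes P N r l" "P' = P(v := length C)" "N' = N(v := Suc (length C))"
      using eq False by (simp_all add: Let_def C_def j_def r_def l_def v_def)
    have len': "length D' = Suc (Suc (length C))" unfolding new by (simp add: length_update_nodes)
    have rep: "repaired (Suc i) \<sigma> = (if circuit_fun (stage j) (repaired i \<sigma>) then repaired i \<sigma>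
      else set_true l (repaired i \<sigma>))" for \<sigma>
      using False by (simp add: j_def l_def)
    have gP: "gate D' (P x) (\<lambda>\<sigma>. repaired i \<sigma> x)" and gN: "gate D' (N x) (\<lambda>\<sigma>. \<not> repaired i \<sigma> x)"
      and PN: "P x \<noteq> 2" "N x \<noteq> 2" "N x \<noteq> 0" if "x \<in> set X" for x
      using that invC gate_append unfolding built_def new by blast+
    have gr: "gate D' r (\<lambda>\<sigma>. circuit_fun (stage j) (repaired i \<sigma>))"
      "gate D' (Suc r) (\<lambda>\<sigma>. \<not> circuit_fun (stage j) (repaired i \<sigma>))"
      using root gate_append unfolding new by blast+
    have gv: "gate D' (length C) (\<lambda>\<sigma>. repaired (Suc i) \<sigma> v) \<and>
      gate D' (Suc (length C)) (\<lambda>\<sigma>. \<not> repaired (Suc i) \<sigma> v)"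
    proof (cases l)
      case (Pos w)
      then have "w = v" unfolding v_def by simp
      then have nth: "D' ! length C = OrN (P v) (Suc r)" "D' ! Suc (length C) = AndN (N v) r"
        unfolding new Pos by (simp_all add: nth_append)
      have "gate D' (length C) (\<lambda>\<sigma>. repaired i \<sigma> v \<or> \<not> circuit_fun (stage j) (repaired i \<sigma>))"
        by (rule gate.disj[OF _ nth(1) gP[OF v] gr(2)]) (simp add: len')
      moreover have "gate D' (Suc (length C)) (\<lambda>\<sigma>. \<not> repaired i \<sigma> v \<and> circuit_fun (stage j) (repaired i \<sigma>))"
        by (rule gate.conj[OF _ nth(2) gN[OF v] gr(1)]) (simp add: len')
      moreover have "repaired (Suc i) \<sigma> v = (repaired i \<sigma> v \<or> \<not> circuit_fun (stage j) (repaired i \<sigma>))" for \<sigma>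
        unfolding rep using \<open>w = v\<close> Pos by simp
      ultimately show ?thesis by simp
    next
      case (Neg w)
      then have "w = v" unfolding v_def by simp
      then have nth: "D' ! length C = AndN (P v) r" "D' ! Suc (length C) = OrN (N v) (Suc r)"
        unfolding new Neg by (simp_all add: nth_append)
      have "gate D' (length C) (\<lambda>\<sigma>. repaired i \<sigma> v \<and> circuit_fun (stage j) (repaired i \<sigma>))"
        by (rule gate.conj[OF _ nth(1) gP[OF v] gr(1)]) (simp add: len')
      moreover have "gate D' (Suc (length C)) (\<lambda>\<sigma>. \<not> repaired i \<sigma> v \<or> \<not> circuit_fun (stage j) (repaired i \<sigma>))"
        by (rule gate.disj[OF _ nth(2) gN[OF v] gr(2)]) (simp add: len')
      moreover have "repaired (Suc i) \<sigma> v = (repaired i \<sigma> v \<and> circuit_fun (stage j) (repaired i \<sigma>))" for \<sigma>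
        unfolding rep using \<open>w = v\<close> Neg by simp
      ultimately show ?thesis by simp
    qed
    have sound': "sound_nodes (set I) D'"
      unfolding new(1)
    proof (rule sound_nodes_append[OF soundC]; (unfold new(1)[symmetric])?)
      fix u assume "u < length (update_nodes P N r l)"
      then have "u = 0 \<or> u = 1" unfolding length_update_nodes by auto
      then show "\<exists>f. gate D' (length C + u) f" using gv by auto
    next
      \<comment> \<open>Old values lie inside \<open>D\<close> and the copied root behind it, so the
        children of the update nodes differ.\<close>
      have "P v < length D" "N v < length D"
        using inv v gate_less unfolding built_def by blast+
      then show "\<forall>nd \<in> set (update_nodes P N r l). two_children nd"
        unfolding r_def v_def by (cases l) auto
      show "\<forall>l'. Leaf (Lit l') \<in> set (update_nodes P N r l) \<longrightarrow> lit_var l' \<in> set I"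
        by (cases l) auto
    qed
    have other: "repaired (Suc i) \<sigma> x = repaired i \<sigma> x" if "x \<noteq> v" for \<sigma> x
      unfolding rep using set_true_other that v_def by simp
    have C3: "3 \<le> length C" "C ! 0 = Leaf (Cst False)" "C ! 2 = Leaf (Cst True)"
      using invC unfolding built_def by simp_all
    have "gate D' (P' x) (\<lambda>\<sigma>. repaired (Suc i) \<sigma> x) \<and> gate D' (N' x) (\<lambda>\<sigma>. \<not> repaired (Suc i) \<sigma> x) \<and>
        P' x \<noteq> 2 \<and> N' x \<noteq> 2 \<and> N' x \<noteq> 0" if "x \<in> set X" for x
    proof (cases "x = v")
      case True then show ?thesis using gv C3(1) unfolding new(2,3) by simp
    next
      case False
      then show ?thesis using gP[OF that] gN[OF that] PN[OF that] other unfolding new(2,3) by simp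
    qed
    moreover have "N' x = 0" if "x \<notin> set X" for x
      using that v inv unfolding new(3) built_def by auto
    moreover have "D' ! 0 = Leaf (Cst False)" "D' ! 2 = Leaf (Cst True)"
      using C3 unfolding new(1) by (auto simp: nth_append)
    ultimately show ?thesis using sound' C3(1) len' unfolding built_def by simp
  qed
qed

lemma built_0: "build 0 = (D, P, N) \<Longrightarrow> built 0 D P N"
proof -
  assume b: "build 0 = (D, P, N)"
  have D: "D = [Leaf (Cst False), Leaf (Cst True), Leaf (Cst True)]" "P = (\<lambda>_. 0)"
    "N = (\<lambda>v. if v \<in> set X then 1 else 0)"
    using b by auto
  have leaves: "\<exists>b. D ! u = Leaf (Cst b)" if "u < length D" for u
    using that unfolding D by (auto simp: less_Suc_eq)
  have gates: "gate D u (label_val (Cst c))" if "u < length D" "D ! u = Leaf (Cst c)" for u c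
    using that by (rule gate.leaf)
  have "sound_nodes (set I) D"
  proof -
    have "\<exists>f. gate D u f" if "u < length D" for u using gates[OF that] leaves[OF that] by blast
    then show ?thesis unfolding sound_nodes_def by (simp add: D(1))
  qed
  then show ?thesis
    using gates[of 0 False] gates[of 1 True] unfolding built_def by (simp add: D label_val_Cst)
qed

lemma built_build: "i \<le> k \<Longrightarrow> build i = (D, P, N) \<Longrightarrow> built i D P N"
proof (induction i arbitrary: D P N)
  case (Suc i)
  obtain D0 P0 N0 where b: "build i = (D0, P0, N0)" by (cases "build i")
  show ?case using built_next_level[OF Suc.IH[OF _ b]] Suc.prems b by simp
qed (rule built_0)

text \<open>Sending node 0 through \<open>finished\<close> would cost a copy of the whole list per
  output; with this case only the outputs counted by \<open>touched\<close> pay for it.\<close>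

definition skolem_circuit :: "node list \<Rightarrow> nat \<Rightarrow> circuit" where
  "skolem_circuit D r = (if r = 0 then bottom_circuit else finished D r)"

lemma skolem_circuit_correct:
  assumes "build k = (D, P, N)" "v \<in> set X"
  shows "circuit_over (set I) (skolem_circuit D (P v))"
    "circuit_fun (skolem_circuit D (P v)) = (\<lambda>\<sigma>. repaired k \<sigma> v)"
proof -
  have inv: "built k D P N" using built_build assms(1) by simp
  have g: "gate D (P v) (\<lambda>\<sigma>. repaired k \<sigma> v)" using inv assms(2) unfolding built_def by blast
  have sound: "sound_nodes (set I) D" using inv unfolding built_def by simp
  show "circuit_over (set I) (skolem_circuit D (P v))"
    using bottom_circuit_correct(1) finished_correct(1)[OF sound g] unfolding skolem_circuit_def by simp
  show "circuit_fun (skolem_circuit D (P v)) = (\<lambda>\<sigma>. repaired k \<sigma> v)"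
  proof (cases "P v = 0")
    case False
    then show ?thesis using finished_correct(2)[OF sound g] unfolding skolem_circuit_def by simp
  next
    case True
    have D0: "D ! 0 = Leaf (Cst False)" using inv unfolding built_def by simp
    have "(\<lambda>\<sigma>. repaired k \<sigma> v) = label_val (Cst False)"
      using g unfolding True by cases (simp_all add: D0)
    then show ?thesis using True bottom_circuit_correct(2) unfolding skolem_circuit_def
      by (simp add: label_val_Cst)
  qed
qed

theorem skolem_vector_build:
  assumes "build k = (D, P, N)"
  shows "skolem_vector I X G (map (\<lambda>v. skolem_circuit D (P v)) X)"
proof -
  have map: "map_of (zip X (map f X)) v = (if v \<in> set X then Some (f v) else None)" for f :: "nat \<Rightarrow> circuit" and v
    by (induction X) auto
  have "subst_outputs X (map (\<lambda>v. skolem_circuit D (P v)) X) \<sigma> = repaired k \<sigma>" for \<sigma>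
    by (rule ext) (simp add: subst_outputs_def map skolem_circuit_correct(2)[OF assms] repaired_input)
  then show ?thesis
    unfolding skolem_vector_def using skolem_circuit_correct(1)[OF assms] repaired_correct by auto
qed

text \<open>Three initial constants, then per level two copies of each node and at most two update
  nodes.\<close>

lemma length_build: "build i = (D, P, N) \<Longrightarrow> length D \<le> 3 + i * (2 * n + 2)"
proof (induction i arbitrary: D P N)
  case (Suc i)
  obtain D0 P0 N0 where b: "build i = (D0, P0, N0)" by (cases "build i")
  show ?case using Suc.IH[OF b] Suc.prems b
    by (auto simp: Let_def length_copied length_update_nodes split: if_splits)
qed auto

text \<open>Each level redirects at most one variable. This bound, and not the number of outputs,
  multiplies the length of the node list.\<close>

lemma touched: "build i = (D, P, N) \<Longrightarrow> finite {v. P v \<noteq> 0} \<and> card {v. P v \<noteq> 0} \<le> i"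
proof (induction i arbitrary: D P N)
  case (Suc i)
  obtain D0 P0 N0 where b: "build i = (D0, P0, N0)" by (cases "build i")
  have IH: "finite {v. P0 v \<noteq> 0}" "card {v. P0 v \<noteq> 0} \<le> i" using Suc.IH[OF b] by simp_all
  define x where "x = lit_var (set_lit (k - Suc i))"
  have "{v. P v \<noteq> 0} \<subseteq> insert x {v. P0 v \<noteq> 0}"
    using Suc.prems b unfolding x_def by (auto simp: Let_def split: if_splits)
  moreover have "card (insert x {v. P0 v \<noteq> 0}) \<le> Suc i"
    using IH by (simp add: card_insert_if)
  moreover have "finite (insert x {v. P0 v \<noteq> 0})" using IH(1) by simp
  ultimately show ?case using card_mono finite_subset le_trans by metis
qed auto

end

section \<open>Total correctness with time bounds\<close>

text \<open>Code without loops is evaluated by the function \<open>run\<close>, so that its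
  correctness becomes simplification instead of inversion of \<open>exec\<close>.\<close>

fun loop_free :: "com \<Rightarrow> bool" where
  "loop_free (Seq p q) = (loop_free p \<and> loop_free q)"
| "loop_free (If b p q) = (loop_free p \<and> loop_free q)"
| "loop_free (While b p) = False"
| "loop_free _ = True"

fun run :: "com \<Rightarrow> state \<Rightarrow> state" where
  "run (Assign r e) s = set_reg r (exp_val e s) s"
| "run (Store a e f) s = set_cell a (exp_val e s) (exp_val f s) s"
| "run (Seq p q) s = run q (run p s)"
| "run (If b p q) s = (if test_val b s then run p s else run q s)"
| "run _ s = s"

text \<open>Charging both branches of a conditional makes the bound independent of the
  state.\<close>

fun run_cost :: "com \<Rightarrow> nat" where
  "run_cost (Assign r e) = exp_cost e + 1"
| "run_cost (Store a e f) = exp_cost e + exp_cost f + 1"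
| "run_cost (Seq p q) = run_cost p + run_cost q"
| "run_cost (If b p q) = test_cost b + run_cost p + run_cost q"
| "run_cost _ = 1"

lemma exec_run: "loop_free p \<Longrightarrow> \<exists>t. exec p s t (run p s) \<and> t \<le> run_cost p"
proof (induction p arbitrary: s)
  case (Assign r e) show ?case using exec.Assign[of r e s] by auto
next
  case (Store a e f) show ?case using exec.Store[of a e f s] by auto
next
  case (Seq p q)
  obtain t where t: "exec p s t (run p s)" "t \<le> run_cost p" using Seq.IH(1) Seq.prems by auto
  obtain t' where t': "exec q (run p s) t' (run q (run p s))" "t' \<le> run_cost q"
    using Seq.IH(2) Seq.prems by fastforce
  show ?case using exec.Seq[OF t(1) t'(1)] t(2) t'(2) by (intro exI[of _ "t + t'"]) simp
next
  case (If b p q)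
  show ?case
  proof (cases "test_val b s")
    case True
    obtain t where "exec p s t (run p s)" "t \<le> run_cost p" using If.IH(1) If.prems by auto
    then show ?thesis using True exec.IfTrue[of b s p t "run p s" q]
      by (intro exI[of _ "test_cost b + t"]) simp
  next
    case False
    obtain t where "exec q s t (run q s)" "t \<le> run_cost q" using If.IH(2) If.prems by fastforce
    then show ?thesis using False exec.IfFalse[of b s q t "run q s" p]
      by (intro exI[of _ "test_cost b + t"]) simp
  qed
qed (auto intro: exec.Skip)

definition triple :: "(state \<Rightarrow> bool) \<Rightarrow> com \<Rightarrow> nat \<Rightarrow> (state \<Rightarrow> bool) \<Rightarrow> bool" where
  "triple P p T Q \<longleftrightarrow> (\<forall>s. P s \<longrightarrow> (\<exists>t s'. exec p s t s' \<and> t \<le> T \<and> Q s'))"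

lemma triple_run:
  assumes "loop_free p" "run_cost p \<le> T" "\<And>s. P s \<Longrightarrow> Q (run p s)"
  shows "triple P p T Q"
  unfolding triple_def
proof (intro allI impI)
  fix s assume "P s"
  obtain t where "exec p s t (run p s)" "t \<le> run_cost p" using exec_run assms(1) by blast
  then show "\<exists>t s'. exec p s t s' \<and> t \<le> T \<and> Q s'"
    using assms(2) assms(3)[OF \<open>P s\<close>] le_trans by blast
qed

lemma triple_Seq:
  assumes "triple P p T Q" "triple Q q T' R" "T + T' \<le> T''"
  shows "triple P (Seq p q) T'' R"
  unfolding triple_def
proof (intro allI impI)
  fix s assume "P s"
  then obtain t s' where 1: "exec p s t s'" "t \<le> T" "Q s'" using assms(1) unfolding triple_def by blast
  then obtain t' s'' where 2: "exec q s' t' s''" "t' \<le> T'" "R s''"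
    using assms(2) unfolding triple_def by blast
  have "exec (Seq p q) s (t + t') s''" using 1(1) 2(1) by (rule exec.Seq)
  moreover have "t + t' \<le> T''" using 1(2) 2(2) assms(3) by simp
  ultimately show "\<exists>t s'. exec (Seq p q) s t s' \<and> t \<le> T'' \<and> R s'" using 2(3) by blast
qed

lemma triple_weaken:
  assumes "triple P p T Q" "\<And>s. P' s \<Longrightarrow> P s" "\<And>s. Q s \<Longrightarrow> Q' s" "T \<le> T'"
  shows "triple P' p T' Q'"
  unfolding triple_def
proof (intro allI impI)
  fix s assume "P' s"
  then obtain t s' where "exec p s t s'" "t \<le> T" "Q s'"
    using assms(1,2) unfolding triple_def by blast
  then show "\<exists>t s'. exec p s t s' \<and> t \<le> T' \<and> Q' s'" using assms(3,4) le_trans by blast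
qed

text \<open>The precondition decides the branch, so only that branch is paid for;
  \<open>write_circuit\<close> depends on this, since one of its branches is much more
  expensive.\<close>

lemma triple_If:
  assumes "\<And>s. P s \<Longrightarrow> test_val b s = c" "triple P (if c then p else q) T Q" "test_cost b + T \<le> T'"
  shows "triple P (If b p q) T' Q"
  unfolding triple_def
proof (intro allI impI)
  fix s assume s: "P s"
  then obtain t s' where 1: "exec (if c then p else q) s t s'" "t \<le> T" "Q s'"
    using assms(2) unfolding triple_def by blast
  have "exec (If b p q) s (test_cost b + t) s'"
    using 1(1) assms(1)[OF s] by (cases c) (auto intro: exec.IfTrue exec.IfFalse)
  moreover have "test_cost b + t \<le> T'" using 1(2) assms(3) by simp
  ultimately show "\<exists>t s'. exec (If b p q) s t s' \<and> t \<le> T' \<and> Q s'" using 1(3) by blast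
qed

text \<open>The cost may vary with the iteration, as it does when cheap and expensive outputs are
  written.\<close>

lemma triple_While:
  assumes test: "\<And>i s. i \<le> N \<Longrightarrow> Inv i s \<Longrightarrow> test_val b s = (i < N)"
    and body: "\<And>i. i < N \<Longrightarrow> triple (Inv i) p (T i) (Inv (Suc i))"
    and time: "(\<Sum>i<N. T i + test_cost b) + test_cost b \<le> T'"
  shows "triple (Inv 0) (While b p) T' (Inv N)"
proof -
  have "\<exists>t s'. exec (While b p) s t s' \<and> t \<le> (\<Sum>i=i..<N. T i + test_cost b) + test_cost b \<and> Inv N s'"
    if "i \<le> N" "Inv i s" for i s
    using that
  proof (induction "N - i" arbitrary: i s)
    case 0
    then have "i = N" by simp
    then show ?case using exec.WhileFalse[of b s p] test[OF 0(2,3)] 0(3) by auto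
  next
    case (Suc d)
    then have i: "i < N" by simp
    obtain t s' where 1: "exec p s t s'" "t \<le> T i" "Inv (Suc i) s'"
      using body[OF i] Suc.prems unfolding triple_def by blast
    obtain t' s'' where 2: "exec (While b p) s' t' s''"
      "t' \<le> (\<Sum>i=Suc i..<N. T i + test_cost b) + test_cost b" "Inv N s''"
      using Suc.hyps(1)[of "Suc i" s'] Suc.hyps(2) i 1(3) by force
    have "exec (While b p) s (test_cost b + t + t') s''"
      using test[OF Suc.prems] i 1(1) 2(1) by (intro exec.WhileTrue) auto
    moreover have "test_cost b + t + t' \<le> (\<Sum>i=i..<N. T i + test_cost b) + test_cost b"
      using 1(2) 2(2) i by (simp add: sum.atLeast_Suc_lessThan)
    ultimately show ?case using 2(3) by blast
  qed
  from this[of 0] show ?thesis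
    unfolding triple_def using time by (simp add: atLeast0LessThan) (meson le_trans)
qed

lemma triple_While_uniform:
  assumes "\<And>i s. i \<le> N \<Longrightarrow> Inv i s \<Longrightarrow> test_val b s = (i < N)"
    and "\<And>i. i < N \<Longrightarrow> triple (Inv i) p T (Inv (Suc i))"
    and "N * (T + test_cost b) + test_cost b \<le> T'"
  shows "triple (Inv 0) (While b p) T' (Inv N)"
  using assms by (intro triple_While[where T = "\<lambda>_. T" and Inv = Inv]) simp_all

lemma regs_set_reg [simp]: "regs (set_reg r x s) = (regs s)(r := x)"
  and arrs_set_reg [simp]: "arrs (set_reg r x s) = arrs s"
  and regs_set_cell [simp]: "regs (set_cell a i x s) = regs s"
  and arrs_set_cell [simp]: "arrs (set_cell a i x s) = (arrs s)(a := (arrs s a)(i := x))"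
  by (simp_all add: set_reg_def set_cell_def)

definition stored :: "(nat \<Rightarrow> nat) \<Rightarrow> nat list \<Rightarrow> bool" where
  "stored A ws \<longleftrightarrow> (\<forall>i < length ws. A i = ws ! i)"

lemma stored_snoc: "stored A ws \<Longrightarrow> i = length ws \<Longrightarrow> stored (A(i := x)) (ws @ [x])"
  unfolding stored_def by (auto simp: nth_append less_Suc_eq)

lemma stored_snoc3: "stored A ws \<Longrightarrow> i = length ws \<Longrightarrow>
    stored (A(i := x, Suc i := y, Suc (Suc i) := z)) (ws @ [x, y, z])"
  using stored_snoc[OF stored_snoc[OF stored_snoc[of A ws i x], of "Suc i" y], of "Suc (Suc i)" z]
  by simp

section \<open>The program\<close>

text \<open>The array \<open>D\<close> holds the encoded nodes of the circuit under construction, with write position \<open>rW\<close>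
  and node count \<open>rC\<close>; \<open>P\<close> and \<open>N\<close> map a variable to the node that computes its current value and
  to the node that computes the negation. \<open>Mark\<close> maps a node to the 1-based index of its leaf set
  (0 if there is none), and \<open>First\<close> maps such an index to the input address of a leaf of the set (0 if
  the set is empty). The machine has no addition, so the tables \<open>Adr\<close> and \<open>Add\<close> stand in for the
  address computations \<open>2 + 3 * u\<close> and \<open>off + 2 * u\<close>. Variables index arrays directly, so their
  magnitude does not matter.\<close>

abbreviation seq :: "com \<Rightarrow> com \<Rightarrow> com" (infixr ";;" 60) where "p ;; q \<equiv> Seq p q"

abbreviation (input) "rP \<equiv> 0 :: nat"
abbreviation (input) "rU \<equiv> 1 :: nat"
abbreviation (input) "rK \<equiv> 2 :: nat"
abbreviation (input) "rJ \<equiv> 3 :: nat"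
abbreviation (input) "rQ \<equiv> 4 :: nat"
abbreviation (input) "rI \<equiv> 5 :: nat"
abbreviation (input) "rX \<equiv> 6 :: nat"
abbreviation (input) "rW \<equiv> 7 :: nat"
abbreviation (input) "rC \<equiv> 8 :: nat"
abbreviation (input) "rT \<equiv> 9 :: nat"
abbreviation (input) "rO \<equiv> 10 :: nat"
abbreviation (input) "rV \<equiv> 11 :: nat"
abbreviation (input) "rL \<equiv> 12 :: nat"
abbreviation (input) "rM \<equiv> 13 :: nat"
abbreviation (input) "rKind \<equiv> 14 :: nat"
abbreviation (input) "rA \<equiv> 15 :: nat"
abbreviation (input) "rB \<equiv> 16 :: nat"
abbreviation (input) "rF \<equiv> 17 :: nat"
abbreviation (input) "rR \<equiv> 18 :: nat"

abbreviation (input) "aIn \<equiv> 0 :: nat"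
abbreviation (input) "aOut \<equiv> 1 :: nat"
abbreviation (input) "aD \<equiv> 2 :: nat"
abbreviation (input) "aP \<equiv> 3 :: nat"
abbreviation (input) "aN \<equiv> 4 :: nat"
abbreviation (input) "aMark \<equiv> 5 :: nat"
abbreviation (input) "aFirst \<equiv> 6 :: nat"
abbreviation (input) "aAdr \<equiv> 7 :: nat"
abbreviation (input) "aAdd \<equiv> 8 :: nat"

abbreviation "incr r \<equiv> Assign r (Inc (Reg r))"
abbreviation "incr3 r \<equiv> Assign r (Inc (Inc (Inc (Reg r))))"

text \<open>Cell 0 of the input holds the root; the length prefix of the node list follows
  it.\<close>

abbreviation "number_of_nodes \<equiv> Cell aIn (Num 1)"

definition emit :: "exp \<Rightarrow> exp \<Rightarrow> exp \<Rightarrow> com" where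
  "emit e1 e2 e3 =
     (Store aD (Reg rW) e1 ;; Store aD (Inc (Reg rW)) e2 ;; Store aD (Inc (Inc (Reg rW))) e3 ;;
      incr3 rW ;; incr rC)"

definition push :: "nat \<Rightarrow> nat \<Rightarrow> nat \<Rightarrow> state \<Rightarrow> state" where
  "push x y z s = s\<lparr>regs := (regs s)(rW := regs s rW + 3, rC := Suc (regs s rC)),
     arrs := (arrs s)(aD := (arrs s aD)
       (regs s rW := x, Suc (regs s rW) := y, Suc (Suc (regs s rW)) := z))\<rparr>"

text \<open>\<open>emit\<close> stores its first word before it evaluates the others, so an argument
  that reads the array \<open>D\<close> could see a changed cell.\<close>

fun avoids_D :: "exp \<Rightarrow> bool" where
  "avoids_D (Cell a e) = (a \<noteq> aD \<and> avoids_D e)"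
| "avoids_D (Inc e) = avoids_D e"
| "avoids_D (Dec e) = avoids_D e"
| "avoids_D _ = True"

lemma exp_val_avoids_D:
  "avoids_D e \<Longrightarrow> exp_val e (set_cell aD i x s) = exp_val e s"
  by (induction e) auto

lemma run_emit [simp]:
  "avoids_D e1 \<Longrightarrow> avoids_D e2 \<Longrightarrow> avoids_D e3 \<Longrightarrow>
    run (emit e1 e2 e3) s = push (exp_val e1 s) (exp_val e2 s) (exp_val e3 s) s"
  by (simp add: emit_def push_def exp_val_avoids_D)
    (simp add: set_reg_def set_cell_def numeral_3_eq_3)

lemma loop_free_emit [simp]: "loop_free (emit e1 e2 e3)"
  and run_cost_emit [simp]:
    "run_cost (emit e1 e2 e3) = exp_cost e1 + exp_cost e2 + exp_cost e3 + 17"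
  by (simp_all add: emit_def)

lemma regs_push [simp]:
    "regs (push x y z s) = (regs s)(rW := regs s rW + 3, rC := Suc (regs s rC))"
  and arrs_push [simp]: "a \<noteq> aD \<Longrightarrow> arrs (push x y z s) a = arrs s a"
  by (simp_all add: push_def)

definition words :: "node list \<Rightarrow> nat list" where
  "words ns = concat (map enc_node ns)"

lemma length_enc_node: "length (enc_node nd) = 3"
  by (cases nd rule: enc_node.cases) auto

lemma length_words: "length (words ns) = 3 * length ns"
  unfolding words_def by (induction ns) (auto simp: length_enc_node)

definition emitted :: "node list \<Rightarrow> state \<Rightarrow> bool" where
  "emitted ns s \<longleftrightarrow> stored (arrs s aD) (words ns) \<and> regs s rW = 3 * length ns \<and>
     regs s rC = length ns"

lemma emitted_push:
  assumes "emitted ns s" "enc_node nd = [x, y, z]"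
  shows "emitted (ns @ [nd]) (push x y z s)"
  using assms stored_snoc3[of "arrs s aD" "words ns" "regs s rW" x y z] length_words[of ns]
  unfolding emitted_def by (simp add: push_def words_def)

lemma emitted_push2:
  assumes "emitted ns s" "enc_node nd = [x, y, z]" "enc_node nd' = [x', y', z']"
  shows "emitted (ns @ [nd, nd']) (push x' y' z' (push x y z s))"
  using emitted_push[OF emitted_push[OF assms(1,2)] assms(3)] by simp

lemma emitted_set_reg [simp]: "r \<noteq> rW \<Longrightarrow> r \<noteq> rC \<Longrightarrow> emitted ns (set_reg r x s) = emitted ns s"
  and emitted_set_cell [simp]: "a \<noteq> aD \<Longrightarrow> emitted ns (set_cell a i x s) = emitted ns s"
  by (simp_all add: emitted_def)

section \<open>Program: parsing the input\<close>

definition scan_nodes_body :: com where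
  "scan_nodes_body = Store aAdr (Reg rU) (Reg rP) ;; incr3 rP ;; incr rU"

definition scan_nodes :: com where
  "scan_nodes = (Assign rP (Num 2) ;; Assign rU (Num 0)) ;;
     While (Less (Reg rU) number_of_nodes) scan_nodes_body"

definition scan_set_body :: com where
  "scan_set_body = Assign rU (Cell aIn (Reg rP)) ;; Store aMark (Reg rU) (Reg rJ) ;;
     Store aFirst (Reg rJ) (Cell aAdr (Reg rU)) ;; incr rP ;; incr rI"

definition scan_set :: com where
  "scan_set = (incr rJ ;; Assign rQ (Cell aIn (Reg rP)) ;; incr rP ;; Assign rI (Num 0)) ;;
     While (Less (Reg rI) (Reg rQ)) scan_set_body"

definition scan_sets :: com where
  "scan_sets = (Assign rK (Cell aIn (Reg rP)) ;; incr rP ;; Assign rJ (Num 0)) ;;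
     While (Less (Reg rJ) (Reg rK)) scan_set"

text \<open>The value 1 both marks a variable as an output and is the node of the constant true, its
  initial negated value. \<open>P\<close> is zero already.\<close>

definition scan_outputs_body :: com where
  "scan_outputs_body = Store aN (Cell aIn (Reg rP)) (Num 1) ;; incr rP ;; incr rI"

definition scan_outputs :: com where
  "scan_outputs = (Assign rM (Cell aIn (Reg rP)) ;; incr rP ;; Assign rX (Reg rP) ;; Assign rI (Num 0)) ;;
     While (Less (Reg rI) (Reg rM)) scan_outputs_body"

section \<open>Program: one copy of the circuit per level\<close>

definition make_offsets_body :: com where
  "make_offsets_body = Store aAdd (Reg rU) (Reg rQ) ;; Assign rQ (Inc (Inc (Reg rQ))) ;; incr rU"

text \<open>The table depends on the current length of the node list and is therefore rebuilt for
  every level.\<close>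

definition make_offsets :: com where
  "make_offsets = (Assign rU (Num 0) ;; Assign rQ (Reg rC)) ;;
     While (Less (Reg rU) number_of_nodes) make_offsets_body"

abbreviation "emit_const b \<equiv> emit (Num (if b then 1 else 0)) (Num 0) (Num 0)"
abbreviation "switch n p q \<equiv> If (Eq (Reg rKind) (Num n)) p q"
abbreviation "if_input p q \<equiv> If (Eq (Cell aN (Reg rA)) (Num 0)) p q"
abbreviation "offset r \<equiv> Cell aAdd (Reg r)"

text \<open>While level \<open>j\<close> is built, \<open>rJ\<close> holds \<open>Suc j\<close>; as
  marks are 1-based, the first test selects exactly the leaves of the sets before
  \<open>j\<close>.\<close>

definition copy_branches :: com where
  "copy_branches =
     If (And (Less (Num 0) (Cell aMark (Reg rU))) (Less (Cell aMark (Reg rU)) (Reg rJ)))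
       (emit_const True ;; emit_const False)
     (switch 0 (emit_const False ;; emit_const True)
     (switch 1 (emit_const True ;; emit_const False)
     (switch 2 (if_input (emit (Num 2) (Reg rA) (Num 0) ;; emit (Num 3) (Reg rA) (Num 0))
         (emit (Num 4) (Cell aP (Reg rA)) (Num 2) ;; emit (Num 4) (Cell aN (Reg rA)) (Num 2)))
     (switch 3 (if_input (emit (Num 3) (Reg rA) (Num 0) ;; emit (Num 2) (Reg rA) (Num 0))
         (emit (Num 4) (Cell aN (Reg rA)) (Num 2) ;; emit (Num 4) (Cell aP (Reg rA)) (Num 2)))
     (switch 4 (emit (Num 4) (offset rA) (offset rB) ;; emit (Num 5) (Inc (offset rA)) (Inc (offset rB)))
       (emit (Num 5) (offset rA) (offset rB) ;; emit (Num 4) (Inc (offset rA)) (Inc (offset rB))))))))"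

definition copy_node :: com where
  "copy_node =
     Assign rKind (Cell aIn (Reg rP)) ;; Assign rA (Cell aIn (Inc (Reg rP))) ;;
     Assign rB (Cell aIn (Inc (Inc (Reg rP)))) ;; copy_branches ;; incr3 rP ;; incr rU"

definition copy_nodes :: com where
  "copy_nodes = (Assign rU (Num 0) ;; Assign rP (Num 2)) ;; While (Less (Reg rU) number_of_nodes) copy_node"

text \<open>A leaf address is at least 2, so 0 is free to signal an empty set. The word at the
  address gives the sign, the next one the variable. After the two emits, the new nodes are the last
  two below \<open>rC\<close>.\<close>

definition update :: com where
  "update = Assign rF (Cell aFirst (Reg rJ)) ;;
     If (Less (Num 0) (Reg rF))
       (Assign rV (Cell aIn (Inc (Reg rF))) ;; Assign rR (Cell aAdd (Cell aIn (Num 0))) ;;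
        If (Eq (Cell aIn (Reg rF)) (Num 2))
          (emit (Num 5) (Cell aP (Reg rV)) (Inc (Reg rR)) ;; emit (Num 4) (Cell aN (Reg rV)) (Reg rR))
          (emit (Num 4) (Cell aP (Reg rV)) (Reg rR) ;; emit (Num 5) (Cell aN (Reg rV)) (Inc (Reg rR))) ;;
        Store aP (Reg rV) (Dec (Dec (Reg rC))) ;; Store aN (Reg rV) (Dec (Reg rC)))
       Skip ;;
     Assign rJ (Dec (Reg rJ))"

definition build_level :: com where
  "build_level = make_offsets ;; copy_nodes ;; update"

definition build_levels :: com where
  "build_levels = (emit_const False ;; emit_const True ;; emit_const True ;; Assign rJ (Reg rK)) ;;
     While (Less (Num 0) (Reg rJ)) build_level"

definition build_chain_body :: com where
  "build_chain_body = emit (Num 4) (Reg rT) (Reg rU) ;; incr rT ;; incr rU"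

text \<open>The chain does not depend on the root of an output, so it is appended once and shared by
  all of them.\<close>

definition build_chain :: com where
  "build_chain = (Assign rT (Reg rC) ;; Assign rL (Reg rC) ;; emit_const False ;; Assign rU (Num 0)) ;;
     While (Less (Reg rU) (Reg rL)) build_chain_body"

section \<open>Program: writing the output\<close>

definition out :: "exp \<Rightarrow> com" where
  "out e = Store aOut (Reg rO) e ;; incr rO"

definition put :: "nat \<Rightarrow> state \<Rightarrow> state" where
  "put x s = set_reg rO (Suc (regs s rO)) (set_cell aOut (regs s rO) x s)"

lemma out_simps [simp]:
  "loop_free (out e)" "run_cost (out e) = exp_cost e + 5" "run (out e) s = put (exp_val e s) s"
  by (simp_all add: out_def put_def)

lemma regs_put [simp]: "regs (put x s) = (regs s)(rO := Suc (regs s rO))"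
  and arrs_put [simp]: "a \<noteq> aOut \<Longrightarrow> arrs (put x s) a = arrs s a"
  and emitted_put [simp]: "emitted ns (put x s) = emitted ns s"
  by (simp_all add: put_def)

definition written :: "nat list \<Rightarrow> state \<Rightarrow> bool" where
  "written ws s \<longleftrightarrow> stored (arrs s aOut) ws \<and> regs s rO = length ws"

lemma written_put: "written ws s \<Longrightarrow> written (ws @ [x]) (put x s)"
  unfolding written_def put_def by (simp add: stored_snoc)

lemma written_set_reg [simp]: "r \<noteq> rO \<Longrightarrow> written ws (set_reg r x s) = written ws s"
  by (simp add: written_def)

definition copy_out_body :: com where
  "copy_out_body = out (Cell aD (Reg rQ)) ;; incr rQ"

text \<open>Here \<open>rC\<close> is the length of \<open>chained D\<close>, hence the index of the
  root node written last, and the node count is one more.\<close>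

definition write_finished :: com where
  "write_finished = (out (Reg rC) ;; out (Inc (Reg rC)) ;; Assign rQ (Num 0)) ;;
     While (Less (Reg rQ) (Reg rW)) copy_out_body ;;
     (out (Num 5) ;; out (Cell aP (Reg rV)) ;; out (Reg rT) ;; incr rP ;; incr rI)"

text \<open>Root 0, node count 1, and the three words of the leaf for the constant false.\<close>

definition write_bottom :: com where
  "write_bottom = out (Num 0) ;; out (Num 1) ;; out (Num 0) ;; out (Num 0) ;; out (Num 0) ;;
     incr rP ;; incr rI"

definition write_circuit :: com where
  "write_circuit = Assign rV (Cell aIn (Reg rP)) ;;
     If (Eq (Cell aP (Reg rV)) (Num 0)) write_bottom write_finished"

definition write_circuits :: com where
  "write_circuits = (Assign rO (Num 0) ;; out (Reg rM) ;; Assign rI (Num 0) ;; Assign rP (Reg rX)) ;;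
     While (Less (Reg rI) (Reg rM)) write_circuit"

definition skolem_program :: com where
  "skolem_program = scan_nodes ;; scan_sets ;; scan_outputs ;; build_levels ;; build_chain ;; write_circuits"

section \<open>Correctness of the program\<close>

context saunf_instance
begin

section \<open>Layout of the input word\<close>

definition input :: "nat \<Rightarrow> nat" where
  "input = (\<lambda>i. if i < length (enc_input G Ls X I) then enc_input G Ls X I ! i else 0)"

lemma input_nth: "enc_input G Ls X I = xs @ y # ys \<Longrightarrow> length xs = i \<Longrightarrow> input i = y"
  unfolding input_def by auto

text \<open>Address of the length prefix of list \<open>j\<close>: the root, the node count,
  \<open>3 * n\<close> node words and the number of sets come first. At \<open>j = k\<close> it is
  the address of \<open>length X\<close>.\<close>

definition set_pos :: "nat \<Rightarrow> nat" where
  "set_pos j = 3 + 3 * n + length (concat (map enc_nats (take j Ls)))"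

lemma enc_nats_eq: "enc_nats xs = length xs # xs"
  unfolding enc_nats_def enc_list_def by simp

lemma set_pos_Suc: "j < k \<Longrightarrow> set_pos (Suc j) = Suc (set_pos j + length (Ls ! j))"
  unfolding set_pos_def by (simp add: take_Suc_conv_app_nth enc_nats_eq)

lemma enc_input_eq: "enc_input G Ls X I = croot G # n # words (nodes G) @ k #
    concat (map enc_nats Ls) @ length X # X @ enc_nats I"
  unfolding enc_input_def enc_circuit_def enc_list_def words_def enc_nats_eq csize_def by simp

lemma input_header: "input 0 = croot G" "input 1 = n" "input (Suc 0) = n"
  by (simp_all add: input_def enc_input_eq)

lemma length_words_nodes: "length (words (nodes G)) = 3 * n"
  by (simp add: length_words csize_def)

lemma input_node:
  assumes "u < n" "enc_node (nodes G ! u) = [x, y, z]"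
  shows "input (2 + 3 * u) = x" "input (Suc (2 + 3 * u)) = y" "input (Suc (Suc (2 + 3 * u))) = z"
proof -
  have "nodes G = take u (nodes G) @ nodes G ! u # drop (Suc u) (nodes G)"
    using assms(1) unfolding csize_def by (rule id_take_nth_drop)
  then have "words (nodes G) = words (take u (nodes G)) @ [x, y, z] @ words (drop (Suc u) (nodes G))"
    unfolding words_def using assms(2) by (metis concat_append list.simps(9) map_append concat.simps(2))
  then obtain ys where ys: "enc_input G Ls X I =
      croot G # n # words (take u (nodes G)) @ x # y # z # ys"
    unfolding enc_input_eq by simp
  have len: "length (words (take u (nodes G))) = 3 * u"
    using assms(1) by (simp add: length_words csize_def)
  show "input (2 + 3 * u) = x"
    by (rule input_nth[of "croot G # n # words (take u (nodes G))" _ "y # z # ys"])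
      (simp_all add: ys len)
  show "input (Suc (2 + 3 * u)) = y"
    by (rule input_nth[of "croot G # n # words (take u (nodes G)) @ [x]" _ "z # ys"])
      (simp_all add: ys len)
  show "input (Suc (Suc (2 + 3 * u))) = z"
    by (rule input_nth[of "croot G # n # words (take u (nodes G)) @ [x, y]" _ ys])
      (simp_all add: ys len)
qed

lemma input_k: "input (2 + 3 * n) = k"
  by (rule input_nth[of "croot G # n # words (nodes G)"])
    (simp_all add: enc_input_eq length_words_nodes)

lemma input_set:
  assumes "j < k"
  shows "input (set_pos j) = length (Ls ! j)"
    and "i < length (Ls ! j) \<Longrightarrow> input (Suc (set_pos j + i)) = Ls ! j ! i"
proof -
  have "Ls = take j Ls @ Ls ! j # drop (Suc j) Ls"
    using assms by (rule id_take_nth_drop)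
  then have "concat (map enc_nats Ls) = concat (map enc_nats (take j Ls)) @
      enc_nats (Ls ! j) @ concat (map enc_nats (drop (Suc j) Ls))"
    by (metis concat_append list.simps(9) map_append concat.simps(2))
  then obtain ys where ys: "enc_input G Ls X I = (croot G # n # words (nodes G) @ k #
      concat (map enc_nats (take j Ls))) @ length (Ls ! j) # Ls ! j @ ys"
    unfolding enc_input_eq enc_nats_eq[of "Ls ! j"] by simp
  show "input (set_pos j) = length (Ls ! j)"
    by (rule input_nth[OF ys]) (simp add: set_pos_def length_words_nodes)
  assume i: "i < length (Ls ! j)"
  then have "Ls ! j = take i (Ls ! j) @ Ls ! j ! i # drop (Suc i) (Ls ! j)"
    by (rule id_take_nth_drop)
  then have "enc_input G Ls X I = (croot G # n # words (nodes G) @ k #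
      concat (map enc_nats (take j Ls)) @ length (Ls ! j) # take i (Ls ! j)) @
      Ls ! j ! i # drop (Suc i) (Ls ! j) @ ys"
    unfolding ys by simp
  then show "input (Suc (set_pos j + i)) = Ls ! j ! i"
    by (rule input_nth) (use i in \<open>simp add: set_pos_def length_words_nodes\<close>)
qed

lemma input_outputs:
  shows "input (set_pos k) = length X"
    and "i < length X \<Longrightarrow> input (Suc (set_pos k + i)) = X ! i"
proof -
  show "input (set_pos k) = length X"
    by (rule input_nth[of "croot G # n # words (nodes G) @ k # concat (map enc_nats Ls)"])
      (simp_all add: enc_input_eq set_pos_def length_words_nodes)
  assume i: "i < length X"
  then have "X = take i X @ X ! i # drop (Suc i) X" by (rule id_take_nth_drop)
  then have "enc_input G Ls X I = (croot G # n # words (nodes G) @ k #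
      concat (map enc_nats Ls) @ length X # take i X) @ X ! i # drop (Suc i) X @ enc_nats I"
    unfolding enc_input_eq by simp
  then show "input (Suc (set_pos k + i)) = X ! i"
    by (rule input_nth) (use i in \<open>simp add: set_pos_def length_words_nodes\<close>)
qed

lemma element_less: "j < k \<Longrightarrow> i < length (Ls ! j) \<Longrightarrow> Ls ! j ! i < n"
  using forced_leaf(1)[of k "Ls ! j ! i"] unfolding forced_def by fastforce

text \<open>Distinctness of the list bounds the scan of one set by time linear in
  \<open>n\<close>.\<close>

lemma length_set_le: "j < k \<Longrightarrow> length (Ls ! j) \<le> n"
proof -
  assume j: "j < k"
  have "set (Ls ! j) \<subseteq> {..<n}" using element_less[OF j] by (auto simp: in_set_conv_nth)
  moreover have "distinct (Ls ! j)" using distinct_Ls j by simp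
  ultimately show ?thesis using card_mono[of "{..<n}" "set (Ls ! j)"] distinct_card by fastforce
qed

lemma n_pos: "0 < n" using root_less by simp

lemma k_pos: "0 < k" using saunf unfolding saunf_def by simp

text \<open>Scan invariant after \<open>j\<close> whole sets and \<open>i\<close> elements of the
  next. Being an equivalence, it also determines which marks are 0.\<close>

definition marks :: "nat \<Rightarrow> nat \<Rightarrow> (nat \<Rightarrow> nat) \<Rightarrow> bool" where
  "marks j i M \<longleftrightarrow> (\<forall>u j'. M u = Suc j' \<longleftrightarrow>
     (j' < j \<and> u \<in> set (Ls ! j')) \<or> (j' = j \<and> j < k \<and> u \<in> set (take i (Ls ! j))))"

lemma marks_step:
  assumes M: "marks j i M" and j: "j < k" and i: "i < length (Ls ! j)"
  shows "marks j (Suc i) (M(Ls ! j ! i := Suc j))"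
  unfolding marks_def
proof (intro allI)
  fix u j'
  have take: "set (take (Suc i) (Ls ! j)) = insert (Ls ! j ! i) (set (take i (Ls ! j)))"
    using i by (simp add: take_Suc_conv_app_nth)
  \<comment> \<open>By disjointness the overwritten cell held no mark of an earlier set.\<close>
  have "u \<notin> set (Ls ! j')" if "u = Ls ! j ! i" "j' < j"
    using disjoint[of j j'] j i that by (auto simp: disjoint_iff)
  then show "(M(Ls ! j ! i := Suc j)) u = Suc j' \<longleftrightarrow>
     (j' < j \<and> u \<in> set (Ls ! j')) \<or> (j' = j \<and> j < k \<and> u \<in> set (take (Suc i) (Ls ! j)))"
    using M j unfolding take marks_def by auto
qed

lemma marks_next: "j < k \<Longrightarrow> marks j (length (Ls ! j)) M \<Longrightarrow> marks (Suc j) 0 M"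
  unfolding marks_def by (auto simp: less_Suc_eq)

lemma marks_0: "marks 0 0 (\<lambda>_. 0)"
  unfolding marks_def by simp

text \<open>This is the test by which \<open>copy_branches\<close> recognises forced leaves. A leaf
  has a single mark, so no other set can put it into \<open>forced Ls j\<close>.\<close>

lemma marks_forced:
  assumes "marks k 0 M" "j \<le> k" shows "0 < M u \<and> M u < Suc j \<longleftrightarrow> u \<in> forced Ls j"
proof -
  have M: "M u = Suc j' \<longleftrightarrow> j' < k \<and> u \<in> set (Ls ! j')" for j'
    using assms(1) unfolding marks_def by simp
  show ?thesis
  proof (cases "M u")
    case 0
    then show ?thesis using M assms(2) unfolding forced_def by force
  next
    case (Suc j')
    then have j': "j' < k" "u \<in> set (Ls ! j')" using M by auto
    have "i = j'" if "i < j" "u \<in> set (Ls ! i)" for i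
    proof -
      have "M u = Suc i" using M that assms(2) by simp
      then show ?thesis using Suc by simp
    qed
    then show ?thesis using Suc j' unfolding forced_def by auto
  qed
qed

definition first_address :: "nat \<Rightarrow> nat" where
  "first_address j = (if Ls ! j = [] then 0 else 2 + 3 * last (Ls ! j))"

text \<open>\<open>i - 1\<close> is the index of the leaf read last; at the end of the list this is
  the leaf chosen by \<open>set_lit\<close>.\<close>

definition firsts :: "nat \<Rightarrow> nat \<Rightarrow> (nat \<Rightarrow> nat) \<Rightarrow> bool" where
  "firsts j i F \<longleftrightarrow> (\<forall>j'. F (Suc j') = (if j' < j then first_address j'
     else if j' = j \<and> 0 < i then 2 + 3 * (Ls ! j ! (i - 1)) else 0))"

lemma firsts_step: "firsts j i F \<Longrightarrow> firsts j (Suc i) (F(Suc j := 2 + 3 * (Ls ! j ! i)))"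
  unfolding firsts_def by auto

lemma firsts_next: "firsts j (length (Ls ! j)) F \<Longrightarrow> firsts (Suc j) 0 F"
  unfolding firsts_def first_address_def by (auto simp: less_Suc_eq last_conv_nth)

lemma firsts_0: "firsts 0 0 (\<lambda>_. 0)"
  unfolding firsts_def by simp

section \<open>Correctness of the parsing phase\<close>

definition after_scan_nodes :: "nat \<Rightarrow> state \<Rightarrow> bool" where
  "after_scan_nodes u s \<longleftrightarrow> arrs s aIn = input \<and> regs s rU = u \<and> regs s rP = 2 + 3 * u \<and>
     (\<forall>i < u. arrs s aAdr i = 2 + 3 * i) \<and> regs s rW = 0 \<and> regs s rC = 0 \<and>
     (\<forall>a. a \<noteq> aIn \<and> a \<noteq> aAdr \<longrightarrow> arrs s a = (\<lambda>_. 0))"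

text \<open>The numerical bounds here and below are rounded up; the growth in \<open>n\<close>,
  \<open>k\<close> and \<open>length X\<close> is what counts.\<close>

lemma scan_nodes:
  "triple (\<lambda>s. s = init_state (enc_input G Ls X I)) scan_nodes (20 + 20 * n) (after_scan_nodes n)"
  unfolding scan_nodes_def
proof (rule triple_Seq)
  show "triple (\<lambda>s. s = init_state (enc_input G Ls X I)) (Assign rP (Num 2) ;; Assign rU (Num 0)) 4
      (after_scan_nodes 0)"
    by (rule triple_run)
      (auto simp: after_scan_nodes_def init_state_def input_def set_reg_def)
  show "triple (after_scan_nodes 0) (While (Less (Reg rU) number_of_nodes) scan_nodes_body)
      (16 + 20 * n) (after_scan_nodes n)"
  proof (rule triple_While_uniform[where T = 12])
    show "test_val (Less (Reg rU) number_of_nodes) s = (i < n)" if "after_scan_nodes i s" for i s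
      using that by (simp add: after_scan_nodes_def input_header)
    show "triple (after_scan_nodes i) scan_nodes_body 12 (after_scan_nodes (Suc i))" for i
      by (rule triple_run) (auto simp: scan_nodes_body_def after_scan_nodes_def less_Suc_eq)
  qed simp
qed simp

definition after_scan_sets :: "nat \<Rightarrow> state \<Rightarrow> bool" where
  "after_scan_sets j s \<longleftrightarrow> arrs s aIn = input \<and> (\<forall>i < n. arrs s aAdr i = 2 + 3 * i) \<and>
     regs s rW = 0 \<and> regs s rC = 0 \<and> arrs s aP = (\<lambda>_. 0) \<and> arrs s aN = (\<lambda>_. 0) \<and>
     regs s rK = k \<and> regs s rJ = j \<and> regs s rP = set_pos j \<and>
     marks j 0 (arrs s aMark) \<and> firsts j 0 (arrs s aFirst)"

definition in_scan_set :: "nat \<Rightarrow> nat \<Rightarrow> state \<Rightarrow> bool" where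
  "in_scan_set j i s \<longleftrightarrow> arrs s aIn = input \<and> (\<forall>i < n. arrs s aAdr i = 2 + 3 * i) \<and>
     regs s rW = 0 \<and> regs s rC = 0 \<and> arrs s aP = (\<lambda>_. 0) \<and> arrs s aN = (\<lambda>_. 0) \<and>
     regs s rK = k \<and> regs s rJ = Suc j \<and> regs s rP = Suc (set_pos j + i) \<and>
     regs s rI = i \<and> regs s rQ = length (Ls ! j) \<and>
     marks j i (arrs s aMark) \<and> firsts j i (arrs s aFirst)"

lemma scan_set:
  assumes j: "j < k"
  shows "triple (after_scan_sets j) scan_set (20 + 30 * n) (after_scan_sets (Suc j))"
  unfolding scan_set_def
proof (rule triple_Seq)
  show "triple (after_scan_sets j)
      (incr rJ ;; Assign rQ (Cell aIn (Reg rP)) ;; incr rP ;; Assign rI (Num 0)) 12 (in_scan_set j 0)"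
    by (rule triple_run) (auto simp: after_scan_sets_def in_scan_set_def input_set(1)[OF j])
  let ?l = "length (Ls ! j)"
  have "triple (in_scan_set j 0) (While (Less (Reg rI) (Reg rQ)) scan_set_body)
      (3 + 30 * n) (in_scan_set j ?l)"
  proof (rule triple_While_uniform[where T = 20])
    show "test_val (Less (Reg rI) (Reg rQ)) s = (i < ?l)" if "in_scan_set j i s" for i s
      using that by (simp add: in_scan_set_def)
    show "triple (in_scan_set j i) scan_set_body 20 (in_scan_set j (Suc i))" if i: "i < ?l" for i
      by (rule triple_run)
        (use input_set(2)[OF j i] element_less[OF j i] marks_step[OF _ j i] firsts_step[of j i] in
          \<open>auto simp: scan_set_body_def in_scan_set_def\<close>)
    show "?l * (20 + test_cost (Less (Reg rI) (Reg rQ))) + test_cost (Less (Reg rI) (Reg rQ)) \<le> 3 + 30 * n"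
      using length_set_le[OF j] by simp
  qed
  then show "triple (in_scan_set j 0) (While (Less (Reg rI) (Reg rQ)) scan_set_body)
      (3 + 30 * n) (after_scan_sets (Suc j))"
    by (rule triple_weaken)
      (use marks_next[OF j] firsts_next[of j] set_pos_Suc[OF j] in
        \<open>auto simp: after_scan_sets_def in_scan_set_def\<close>)
qed simp

lemma scan_sets:
  "triple (after_scan_nodes n) scan_sets (20 + k * (30 + 30 * n)) (after_scan_sets k)"
  unfolding scan_sets_def
proof (rule triple_Seq)
  show "triple (after_scan_nodes n)
      (Assign rK (Cell aIn (Reg rP)) ;; incr rP ;; Assign rJ (Num 0)) 10 (after_scan_sets 0)"
    by (rule triple_run)
      (auto simp: after_scan_nodes_def after_scan_sets_def input_k[simplified] set_pos_def marks_0 firsts_0)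
  show "triple (after_scan_sets 0) (While (Less (Reg rJ) (Reg rK)) scan_set)
      (10 + k * (30 + 30 * n)) (after_scan_sets k)"
  proof (rule triple_While_uniform[where T = "20 + 30 * n"])
    show "test_val (Less (Reg rJ) (Reg rK)) s = (i < k)" if "after_scan_sets i s" for i s
      using that by (simp add: after_scan_sets_def)
    show "triple (after_scan_sets i) scan_set (20 + 30 * n) (after_scan_sets (Suc i))" if "i < k" for i
      using that by (rule scan_set)
  qed (simp add: add_mult_distrib2)
qed simp

text \<open>What parsing leaves behind for the later phases, none of which changes it.\<close>

definition parsed :: "state \<Rightarrow> bool" where
  "parsed s \<longleftrightarrow> arrs s aIn = input \<and> regs s rK = k \<and> regs s rX = Suc (set_pos k) \<and>
     regs s rM = length X \<and> marks k 0 (arrs s aMark) \<and> firsts k 0 (arrs s aFirst)"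

definition after_scan_outputs :: "nat \<Rightarrow> state \<Rightarrow> bool" where
  "after_scan_outputs i s \<longleftrightarrow> parsed s \<and> regs s rW = 0 \<and> regs s rC = 0 \<and> arrs s aP = (\<lambda>_. 0) \<and>
     arrs s aN = (\<lambda>v. if v \<in> set (take i X) then 1 else 0) \<and> regs s rI = i \<and>
     regs s rP = Suc (set_pos k + i)"

lemma scan_outputs:
  "triple (after_scan_sets k) scan_outputs (20 + 20 * length X) (after_scan_outputs (length X))"
  unfolding scan_outputs_def
proof (rule triple_Seq)
  show "triple (after_scan_sets k)
      (Assign rM (Cell aIn (Reg rP)) ;; incr rP ;; Assign rX (Reg rP) ;; Assign rI (Num 0)) 12
      (after_scan_outputs 0)"
    by (rule triple_run)
      (auto simp: after_scan_sets_def after_scan_outputs_def parsed_def input_outputs(1))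
  show "triple (after_scan_outputs 0) (While (Less (Reg rI) (Reg rM)) scan_outputs_body)
      (8 + 20 * length X) (after_scan_outputs (length X))"
  proof (rule triple_While_uniform[where T = 16])
    show "test_val (Less (Reg rI) (Reg rM)) s = (i < length X)" if "after_scan_outputs i s" for i s
      using that by (simp add: after_scan_outputs_def parsed_def)
    show "triple (after_scan_outputs i) scan_outputs_body 16 (after_scan_outputs (Suc i))"
      if i: "i < length X" for i
      by (rule triple_run)
        (use input_outputs(2)[OF i] i in
          \<open>auto simp: scan_outputs_body_def after_scan_outputs_def parsed_def take_Suc_conv_app_nth
            fun_eq_iff\<close>)
  qed simp
qed simp


section \<open>Correctness of the building phase\<close>

definition building :: "nat \<Rightarrow> node list \<Rightarrow> (nat \<Rightarrow> nat) \<Rightarrow> (nat \<Rightarrow> nat) \<Rightarrow> state \<Rightarrow> bool" where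
  "building j D P N s \<longleftrightarrow> parsed s \<and> emitted D s \<and> arrs s aP = P \<and> arrs s aN = N \<and> regs s rJ = j"

definition offsets_made :: "nat \<Rightarrow> node list \<Rightarrow> state \<Rightarrow> bool" where
  "offsets_made i D s \<longleftrightarrow> (\<forall>a < i. arrs s aAdd a = length D + 2 * a)"

lemma make_offsets:
  "triple (building j D P N) make_offsets (20 + 20 * n)
     (\<lambda>s. building j D P N s \<and> offsets_made n D s)"
  unfolding make_offsets_def
proof (rule triple_Seq)
  let ?Inv = "\<lambda>i s. building j D P N s \<and> offsets_made i D s \<and> regs s rU = i \<and>
    regs s rQ = length D + 2 * i"
  show "triple (building j D P N) (Assign rU (Num 0) ;; Assign rQ (Reg rC)) 4 (?Inv 0)"
    by (rule triple_run) (auto simp: building_def offsets_made_def parsed_def emitted_def)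
  have "triple (?Inv 0) (While (Less (Reg rU) number_of_nodes) make_offsets_body)
      (16 + 20 * n) (?Inv n)"
  proof (rule triple_While_uniform[where T = 13])
    show "test_val (Less (Reg rU) number_of_nodes) s = (i < n)" if "?Inv i s" for i s
      using that by (simp add: building_def parsed_def input_header)
    show "triple (?Inv i) make_offsets_body 13 (?Inv (Suc i))" for i
      by (rule triple_run)
        (auto simp: make_offsets_body_def building_def offsets_made_def parsed_def less_Suc_eq)
  qed simp
  then show "triple (?Inv 0) (While (Less (Reg rU) number_of_nodes) make_offsets_body)
      (16 + 20 * n) (\<lambda>s. building j D P N s \<and> offsets_made n D s)"
    by (rule triple_weaken) simp_all
qed simp

text \<open>Level \<open>j\<close> is copied while \<open>rJ\<close> still holds
  \<open>Suc j\<close>; \<open>update\<close> decrements it at the end.\<close>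

definition copying :: "nat \<Rightarrow> node list \<Rightarrow> (nat \<Rightarrow> nat) \<Rightarrow> (nat \<Rightarrow> nat) \<Rightarrow> nat \<Rightarrow> state \<Rightarrow> bool" where
  "copying j D P N i s \<longleftrightarrow>
     building (Suc j) (D @ concat (map (copies P N (length D)) (take i (nodes (stage j))))) P N s \<and>
     offsets_made n D s \<and> regs s rU = i \<and> regs s rP = 2 + 3 * i"

lemma copy_node:
  assumes j: "j < k" and i: "i < n"
  shows "triple (copying j D P N i) copy_node 1000 (copying j D P N (Suc i))"
proof (rule triple_run)
  show "loop_free copy_node" "run_cost copy_node \<le> 1000"
    by (simp_all add: copy_node_def copy_branches_def)
  fix s assume s: "copying j D P N i s"
  define ns where "ns = D @ concat (map (copies P N (length D)) (take i (nodes (stage j))))"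
  define nd where "nd = nodes G ! i"
  have b: "parsed s" "emitted ns s" "arrs s aP = P" "arrs s aN = N" "regs s rJ = Suc j"
    "offsets_made n D s" "regs s rU = i" "regs s rP = 2 + 3 * i"
    using s unfolding copying_def building_def ns_def by simp_all
  have inp: "arrs s aIn = input" using b(1) unfolding parsed_def by simp
  have forced: "(0 < arrs s aMark i \<and> arrs s aMark i < Suc j) = (i \<in> forced Ls j)"
    using b(1) marks_forced[of "arrs s aMark" j i] j unfolding parsed_def by simp
  have take: "D @ concat (map (copies P N (length D)) (take (Suc i) (nodes (stage j)))) =
      ns @ copies P N (length D) (if i \<in> forced Ls j then Leaf (Cst True) else nd)"
    unfolding ns_def nd_def using i
    by (simp add: take_Suc_conv_app_nth length_nodes_stage) (simp add: stage_def)
  obtain x y z where xyz: "enc_node nd = [x, y, z]"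
    using length_enc_node[of nd] by (auto simp: length_Suc_conv numeral_3_eq_3)
  have in_xyz: "input (2 + 3 * i) = x" "input (Suc (2 + 3 * i)) = y" "input (Suc (Suc (2 + 3 * i))) = z"
    using input_node[OF i] xyz unfolding nd_def by simp_all
  have child: "a < n" if "a \<in> children nd" for a
    using wf i that unfolding wf_circuit_def nd_def by blast
  define s0 where "s0 = set_reg rB z (set_reg rA y (set_reg rKind x s))"
  have e0: "emitted ns s0" unfolding s0_def using b(2) by simp
  have run_eq: "run copy_node s = run (incr3 rP ;; incr rU) (run copy_branches s0)"
    unfolding copy_node_def s0_def using in_xyz b(8) inp by simp
  have test: "test_val (And (Less (Num 0) (Cell aMark (Reg rU))) (Less (Cell aMark (Reg rU)) (Reg rJ))) s0 =
      (i \<in> forced Ls j)"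
    using forced b unfolding s0_def by simp
  have regs0: "regs s0 rKind = x" "regs s0 rA = y" "regs s0 rB = z" unfolding s0_def by simp_all
  have arrs0: "arrs s0 aP = P" "arrs s0 aN = N" "\<And>a. a < n \<Longrightarrow> arrs s0 aAdd a = length D + 2 * a"
    using b unfolding s0_def offsets_made_def by simp_all
  \<comment> \<open>Each branch emits exactly two nodes; once these are named, \<open>intro\<close>
    leaves only their encodings to be computed.\<close>
  let ?goal = "\<exists>x1 y1 z1 x2 y2 z2. run copy_branches s0 = push x2 y2 z2 (push x1 y1 z1 s0) \<and>
    emitted (ns @ copies P N (length D) (if i \<in> forced Ls j then Leaf (Cst True) else nd))
      (push x2 y2 z2 (push x1 y1 z1 s0))"
  have intro: ?goal
    if "run copy_branches s0 = push x2 y2 z2 (push x1 y1 z1 s0)"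
      "copies P N (length D) (if i \<in> forced Ls j then Leaf (Cst True) else nd) = [n1, n2]"
      "enc_node n1 = [x1, y1, z1]" "enc_node n2 = [x2, y2, z2]" for x1 y1 z1 x2 y2 z2 n1 n2
    unfolding that(2)
    by (intro exI[of _ x1] exI[of _ y1] exI[of _ z1] exI[of _ x2] exI[of _ y2] exI[of _ z2] conjI
        that(1) emitted_push2[OF e0 that(3,4)])
  have ?goal
  proof (cases "i \<in> forced Ls j")
    case True
    show ?thesis
      by (rule intro[of 0 0 0 1 0 0 "Leaf (Cst True)" "Leaf (Cst False)"])
        (use True in \<open>unfold copy_branches_def run.simps test if_P[OF True], simp_all\<close>)
  next
    case unforced: False
    note branches = copy_branches_def run.simps test if_not_P[OF unforced]
    show ?thesis
    proof (cases nd)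
      case (Leaf l)
      show ?thesis
      proof (cases l)
        case (Cst c)
        show ?thesis
        proof (cases c)
          case True
          have xyz': "x = 1" "y = 0" "z = 0" using xyz Leaf Cst True by simp_all
          show ?thesis
            by (rule intro[of 0 0 0 1 0 0 "Leaf (Cst True)" "Leaf (Cst False)"])
              (use Leaf Cst True in \<open>unfold branches, simp_all add: regs0 xyz'\<close>)
        next
          case False
          have xyz': "x = 0" "y = 0" "z = 0" using xyz Leaf Cst False by simp_all
          show ?thesis
            by (rule intro[of 1 0 0 0 0 0 "Leaf (Cst False)" "Leaf (Cst True)"])
              (use Leaf Cst False in \<open>unfold branches, simp_all add: regs0 xyz'\<close>)
        qed
      next
        case (Lit l')
        show ?thesis
        proof (cases l')
          case (Pos v)
          have xyz': "x = 2" "y = v" "z = 0" using xyz Leaf Lit Pos by simp_all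
          show ?thesis
          proof (cases "N v = 0")
            case True
            show ?thesis
              by (rule intro[of 3 v 0 2 v 0 "Leaf (Lit (Pos v))" "Leaf (Lit (Neg v))"])
                (use Leaf Lit Pos True in \<open>unfold branches, simp_all add: regs0 xyz' arrs0\<close>)
          next
            case False
            show ?thesis
              by (rule intro[of 4 "N v" 2 4 "P v" 2 "AndN (P v) 2" "AndN (N v) 2"])
                (use Leaf Lit Pos False in \<open>unfold branches, simp_all add: regs0 xyz' arrs0\<close>)
          qed
        next
          case (Neg v)
          have xyz': "x = 3" "y = v" "z = 0" using xyz Leaf Lit Neg by simp_all
          show ?thesis
          proof (cases "N v = 0")
            case True
            show ?thesis
              by (rule intro[of 2 v 0 3 v 0 "Leaf (Lit (Neg v))" "Leaf (Lit (Pos v))"])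
                (use Leaf Lit Neg True in \<open>unfold branches, simp_all add: regs0 xyz' arrs0\<close>)
          next
            case False
            show ?thesis
              by (rule intro[of 4 "P v" 2 4 "N v" 2 "AndN (N v) 2" "AndN (P v) 2"])
                (use Leaf Lit Neg False in \<open>unfold branches, simp_all add: regs0 xyz' arrs0\<close>)
          qed
        qed
      qed
    next
      case (AndN a c)
      have xyz': "x = 4" "y = a" "z = c" using xyz AndN by simp_all
      \<comment> \<open>The table \<open>Add\<close> is filled only below \<open>n\<close>.\<close>
      have "a < n" "c < n" using child AndN by simp_all
      then show ?thesis
        by (intro intro[of 5 "Suc (length D + 2 * a)" "Suc (length D + 2 * c)" 4 "length D + 2 * a"
              "length D + 2 * c" "AndN (length D + 2 * a) (length D + 2 * c)"
              "OrN (Suc (length D + 2 * a)) (Suc (length D + 2 * c))"])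
          (use AndN in \<open>unfold branches, simp_all add: regs0 xyz' arrs0\<close>)
    next
      case (OrN a c)
      have xyz': "x = 5" "y = a" "z = c" using xyz OrN by simp_all
      have "a < n" "c < n" using child OrN by simp_all
      then show ?thesis
        by (intro intro[of 4 "Suc (length D + 2 * a)" "Suc (length D + 2 * c)" 5 "length D + 2 * a"
              "length D + 2 * c" "OrN (length D + 2 * a) (length D + 2 * c)"
              "AndN (Suc (length D + 2 * a)) (Suc (length D + 2 * c))"])
          (use OrN in \<open>unfold branches, simp_all add: regs0 xyz' arrs0\<close>)
    qed
  qed
  then obtain x1 y1 z1 x2 y2 z2 where fin: "run copy_branches s0 = push x2 y2 z2 (push x1 y1 z1 s0)"
    "emitted (D @ concat (map (copies P N (length D)) (take (Suc i) (nodes (stage j)))))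
      (push x2 y2 z2 (push x1 y1 z1 s0))"
    unfolding take by blast
  show "copying j D P N (Suc i) (run copy_node s)"
    unfolding copying_def building_def run_eq fin(1)
    using fin(2) b by (simp add: s0_def parsed_def offsets_made_def)
qed

lemma copy_nodes:
  assumes j: "j < k"
  shows "triple (\<lambda>s. building (Suc j) D P N s \<and> offsets_made n D s) copy_nodes (20 + 1010 * n)
     (\<lambda>s. building (Suc j) (copied D P N j) P N s \<and> offsets_made n D s)"
  unfolding copy_nodes_def
proof (rule triple_Seq)
  show "triple (\<lambda>s. building (Suc j) D P N s \<and> offsets_made n D s)
      (Assign rU (Num 0) ;; Assign rP (Num 2)) 4 (copying j D P N 0)"
    by (rule triple_run) (auto simp: building_def offsets_made_def parsed_def copying_def)
  have "triple (copying j D P N 0) (While (Less (Reg rU) number_of_nodes) copy_node)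
      (16 + 1010 * n) (copying j D P N n)"
  proof (rule triple_While_uniform[where T = 1000])
    show "test_val (Less (Reg rU) number_of_nodes) s = (i < n)" if "copying j D P N i s" for i s
      using that by (simp add: copying_def building_def parsed_def input_header)
    show "triple (copying j D P N i) copy_node 1000 (copying j D P N (Suc i))" if "i < n" for i
      using j that by (rule copy_node)
  qed simp
  then show "triple (copying j D P N 0) (While (Less (Reg rU) number_of_nodes) copy_node)
      (16 + 1010 * n) (\<lambda>s. building (Suc j) (copied D P N j) P N s \<and> offsets_made n D s)"
    by (rule triple_weaken) (simp_all add: copying_def copied_def length_nodes_stage)
qed simp

lemma update:
  assumes j: "j < k" and nxt: "next_level j (D, P, N) = (D', P', N')"
  shows "triple (\<lambda>s. building (Suc j) (copied D P N j) P N s \<and> offsets_made n D s) update 300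
     (building j D' P' N')"
proof (rule triple_run)
  show "loop_free update" "run_cost update \<le> 300" by (simp_all add: update_def)
  fix s assume s: "building (Suc j) (copied D P N j) P N s \<and> offsets_made n D s"
  define C where "C = copied D P N j"
  have b: "parsed s" "emitted C s" "arrs s aP = P" "arrs s aN = N" "regs s rJ = Suc j"
    using s unfolding building_def C_def by simp_all
  have inp: "arrs s aIn = input" using b(1) unfolding parsed_def by simp
  have first: "arrs s aFirst (Suc j) = first_address j"
    using b(1) j unfolding parsed_def firsts_def by simp
  have root: "arrs s aAdd (croot G) = length D + 2 * croot G"
    using s root_less unfolding offsets_made_def by simp
  show "building j D' P' N' (run update s)"
  proof (cases "Ls ! j = []")
    case True
    then have "D' = C" "P' = P" "N' = N" using nxt by (auto simp: Let_def C_def)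
    then show ?thesis using b first True
      by (simp add: update_def building_def first_address_def parsed_def)
  next
    case False
    define l where "l = set_lit j"
    define v where "v = lit_var l"
    define r where "r = length D + 2 * croot G"
    define f where "f = 2 + 3 * last (Ls ! j)"
    have new: "D' = C @ update_nodes P N r l" "P' = P(v := length C)" "N' = N(v := Suc (length C))"
      using nxt False by (simp_all add: Let_def C_def r_def l_def v_def)
    have f: "first_address j = f" "0 < f" using False unfolding first_address_def f_def by simp_all
    have node: "last (Ls ! j) < n" "nodes G ! last (Ls ! j) = Leaf (Lit l)"
      using set_lit(3,4)[OF j False] unfolding l_def by simp_all
    define s1 where "s1 = set_reg rR r (set_reg rV v (set_reg rF f s))"
    have e1: "emitted C s1" using b(2) unfolding s1_def by simp
    have s1: "regs s1 rR = r" "regs s1 rV = v" "arrs s1 aP = P" "arrs s1 aN = N"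
      unfolding s1_def using b by simp_all
    have cnt: "regs s rC = length C" using b(2) unfolding emitted_def by simp
    show ?thesis
    proof (cases l)
      case (Pos w)
      have w: "w = v" using Pos unfolding v_def by simp
      have in_f: "input f = 2" "input (Suc f) = v"
        using input_node(1,2)[OF node(1), of 2 v 0] node(2) Pos w unfolding f_def by simp_all
      have e2: "emitted D' (push 4 (N v) r (push 5 (P v) (Suc r) s1))"
        unfolding new(1) Pos w update_nodes.simps by (rule emitted_push2[OF e1]) simp_all
      have "run update s = set_reg rJ j (set_cell aN v (Suc (length C)) (set_cell aP v (length C)
          (push 4 (N v) r (push 5 (P v) (Suc r) s1))))"
        using b first f in_f inp input_header(1) root s1 cnt
        by (simp add: update_def s1_def r_def)
      then show ?thesis using e2 b
        by (simp add: building_def new(2,3) s1_def parsed_def)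
    next
      case (Neg w)
      have w: "w = v" using Neg unfolding v_def by simp
      have in_f: "input f = 3" "input (Suc f) = v"
        using input_node(1,2)[OF node(1), of 3 v 0] node(2) Neg w unfolding f_def by simp_all
      have e2: "emitted D' (push 5 (N v) (Suc r) (push 4 (P v) r s1))"
        unfolding new(1) Neg w update_nodes.simps by (rule emitted_push2[OF e1]) simp_all
      have "run update s = set_reg rJ j (set_cell aN v (Suc (length C)) (set_cell aP v (length C)
          (push 5 (N v) (Suc r) (push 4 (P v) r s1))))"
        using b first f in_f inp input_header(1) root s1 cnt
        by (simp add: update_def s1_def r_def)
      then show ?thesis using e2 b
        by (simp add: building_def new(2,3) s1_def parsed_def)
    qed
  qed
qed

definition levels :: "nat \<Rightarrow> state \<Rightarrow> bool" where
  "levels i s \<longleftrightarrow> (case build i of (D, P, N) \<Rightarrow> building (k - i) D P N s)"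

lemma build_level:
  assumes i: "i < k"
  shows "triple (levels i) build_level (340 + 1030 * n) (levels (Suc i))"
proof -
  obtain D P N where b: "build i = (D, P, N)" by (cases "build i")
  define j where "j = k - Suc i"
  have j: "j < k" "k - i = Suc j" using i unfolding j_def by simp_all
  obtain D' P' N' where nxt: "next_level j (D, P, N) = (D', P', N')"
    by (cases "next_level j (D, P, N)")
  have l: "levels i = building (Suc j) D P N" "levels (Suc i) = building j D' P' N'"
    using b nxt j(2) by (auto simp: fun_eq_iff levels_def j_def)
  show ?thesis
    unfolding l build_level_def
    by (rule triple_Seq[OF make_offsets triple_Seq[OF copy_nodes[OF j(1)] update[OF j(1) nxt] order.refl]])
      simp
qed

lemma build_levels:
  "triple (after_scan_outputs (length X)) build_levels (100 + k * (350 + 1030 * n)) (levels k)"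
  unfolding build_levels_def
proof (rule triple_Seq)
  show "triple (after_scan_outputs (length X))
      (emit_const False ;; emit_const True ;; emit_const True ;; Assign rJ (Reg rK)) 80 (levels 0)"
  proof (rule triple_run)
    fix s assume s: "after_scan_outputs (length X) s"
    then have "emitted [] s"
      unfolding after_scan_outputs_def emitted_def by (simp add: words_def stored_def)
    from emitted_push[OF emitted_push2[OF this, of "Leaf (Cst False)" 0 0 0 "Leaf (Cst True)" 1 0 0],
        of "Leaf (Cst True)" 1 0 0]
    show "levels 0 (run (emit_const False ;; emit_const True ;; emit_const True ;; Assign rJ (Reg rK)) s)"
      using s by (simp add: levels_def building_def after_scan_outputs_def parsed_def)
  qed simp_all
  show "triple (levels 0) (While (Less (Num 0) (Reg rJ)) build_level)
      (20 + k * (350 + 1030 * n)) (levels k)"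
  proof (rule triple_While_uniform[where T = "340 + 1030 * n"])
    show "test_val (Less (Num 0) (Reg rJ)) s = (i < k)" if "levels i s" for i s
      using that by (auto simp: levels_def building_def split: prod.splits)
    show "triple (levels i) build_level (340 + 1030 * n) (levels (Suc i))" if "i < k" for i
      using that by (rule build_level)
  qed (simp add: add_mult_distrib2)
qed simp

definition chaining :: "node list \<Rightarrow> (nat \<Rightarrow> nat) \<Rightarrow> nat \<Rightarrow> state \<Rightarrow> bool" where
  "chaining D P i s \<longleftrightarrow> parsed s \<and> arrs s aP = P \<and>
     emitted (D @ Leaf (Cst False) # map (\<lambda>i. AndN (length D + i) i) [0..<i]) s \<and>
     regs s rT = length D + i \<and> regs s rL = length D \<and> regs s rU = i"

lemma build_chain:
  assumes b: "build k = (D, P, N)"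
  shows "triple (levels k) build_chain (60 + 40 * length D) (chaining D P (length D))"
  unfolding build_chain_def
proof (rule triple_Seq)
  show "triple (levels k) (Assign rT (Reg rC) ;; Assign rL (Reg rC) ;; emit_const False ;; Assign rU (Num 0)) 40
     (chaining D P 0)"
  proof (rule triple_run)
    fix s assume "levels k s"
    then have s: "building 0 D P N s" unfolding levels_def b by simp
    then have "emitted D (set_reg rL (regs s rC) (set_reg rT (regs s rC) s))"
      unfolding building_def by simp
    from emitted_push[OF this, of "Leaf (Cst False)" 0 0 0] s
    show "chaining D P 0 (run (Assign rT (Reg rC) ;; Assign rL (Reg rC) ;; emit_const False ;;
        Assign rU (Num 0)) s)"
      by (simp add: chaining_def building_def parsed_def) (simp add: emitted_def)
  qed simp_all
  show "triple (chaining D P 0) (While (Less (Reg rU) (Reg rL)) build_chain_body)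
     (20 + 40 * length D) (chaining D P (length D))"
  proof (rule triple_While_uniform[where T = 30])
    show "test_val (Less (Reg rU) (Reg rL)) s = (i < length D)" if "chaining D P i s" for i s
      using that by (simp add: chaining_def)
    show "triple (chaining D P i) build_chain_body 30 (chaining D P (Suc i))" for i
    proof (rule triple_run)
      fix s assume s: "chaining D P i s"
      then have "emitted (D @ Leaf (Cst False) # map (\<lambda>i. AndN (length D + i) i) [0..<i]) s"
        unfolding chaining_def by simp
      from emitted_push[OF this, of "AndN (length D + i) i" 4 "length D + i" i] s
      show "chaining D P (Suc i) (run build_chain_body s)"
        by (simp add: build_chain_body_def chaining_def parsed_def)
    qed (simp_all add: build_chain_body_def)
  qed simp
qed simp


section \<open>Correctness of the writing phase\<close>

definition writing :: "node list \<Rightarrow> (nat \<Rightarrow> nat) \<Rightarrow> nat \<Rightarrow> nat list \<Rightarrow> state \<Rightarrow> bool" where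
  "writing D P i ws s \<longleftrightarrow> parsed s \<and> arrs s aP = P \<and> emitted (chained D) s \<and>
     regs s rT = 2 * length D \<and> regs s rI = i \<and> regs s rP = Suc (set_pos k + i) \<and> written ws s"

definition output_upto :: "node list \<Rightarrow> (nat \<Rightarrow> nat) \<Rightarrow> nat \<Rightarrow> nat list" where
  "output_upto D P i =
     length X # concat (map (\<lambda>v. enc_circuit (skolem_circuit D (P v))) (take i X))"

lemma output_upto_Suc: "i < length X \<Longrightarrow>
    output_upto D P (Suc i) = output_upto D P i @ enc_circuit (skolem_circuit D (P (X ! i)))"
  unfolding output_upto_def by (simp add: take_Suc_conv_app_nth)

text \<open>For \<open>r\<close> other than 0 only the last node depends on \<open>r\<close>; the
  node words before it are copied verbatim from the array \<open>D\<close>.\<close>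

lemma enc_skolem_circuit: "enc_circuit (skolem_circuit D r) =
    (if r = 0 then [0, 1, 0, 0, 0]
     else [Suc (2 * length D), Suc (Suc (2 * length D))] @ words (chained D) @ [5, r, 2 * length D])"
  unfolding skolem_circuit_def bottom_circuit_def finished_def enc_circuit_def enc_list_def words_def
  by (simp add: length_chained)

lemma write_bottom:
  "triple (writing D P i ws) write_bottom 60 (writing D P (Suc i) (ws @ [0, 1, 0, 0, 0]))"
proof (rule triple_run)
  fix s assume s: "writing D P i ws s"
  then have "written ws s" unfolding writing_def by simp
  then have "written (ws @ [0] @ [1] @ [0] @ [0] @ [0]) (put 0 (put 0 (put 0 (put 1 (put 0 s)))))"
    using written_put by (metis append_assoc)
  then show "writing D P (Suc i) (ws @ [0, 1, 0, 0, 0]) (run write_bottom s)"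
    using s by (simp add: write_bottom_def writing_def parsed_def)
qed (simp_all add: write_bottom_def)

lemma write_finished:
  "triple (\<lambda>s. writing D P i ws s \<and> regs s rV = v) write_finished (200 + 80 * length D)
     (writing D P (Suc i) (ws @ [Suc (2 * length D), Suc (Suc (2 * length D))] @ words (chained D) @
       [5, P v, 2 * length D]))"
  unfolding write_finished_def
proof (rule triple_Seq)
  let ?ws = "ws @ [Suc (2 * length D), Suc (Suc (2 * length D))]"
  let ?c = "words (chained D)"
  let ?Inv = "\<lambda>q s. writing D P i (?ws @ take q ?c) s \<and> regs s rV = v \<and> regs s rQ = q"
  have len: "length ?c = 6 * length D + 3" by (simp add: length_words length_chained)
  show "triple (\<lambda>s. writing D P i ws s \<and> regs s rV = v)
      (out (Reg rC) ;; out (Inc (Reg rC)) ;; Assign rQ (Num 0)) 20 (?Inv 0)"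
  proof (rule triple_run)
    fix s assume s: "writing D P i ws s \<and> regs s rV = v"
    then have "regs s rC = Suc (2 * length D)"
      unfolding writing_def emitted_def by (simp add: length_chained)
    then show "?Inv 0 (run (out (Reg rC) ;; out (Inc (Reg rC)) ;; Assign rQ (Num 0)) s)"
      using s written_put[OF written_put[of ws s "regs s rC"], of "Suc (regs s rC)"]
      by (simp add: writing_def parsed_def)
  qed simp_all
  show "triple (?Inv 0) (While (Less (Reg rQ) (Reg rW)) copy_out_body ;;
      (out (Num 5) ;; out (Cell aP (Reg rV)) ;; out (Reg rT) ;; incr rP ;; incr rI))
      (180 + 80 * length D)
      (writing D P (Suc i) (ws @ [Suc (2 * length D), Suc (Suc (2 * length D))] @ ?c @
        [5, P v, 2 * length D]))"
  proof (rule triple_Seq)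
    show "triple (?Inv 0) (While (Less (Reg rQ) (Reg rW)) copy_out_body) (100 + 80 * length D)
        (?Inv (length ?c))"
    proof (rule triple_While_uniform[where T = 10])
      show "test_val (Less (Reg rQ) (Reg rW)) s = (q < length ?c)" if "?Inv q s" for q s
        using that by (simp add: writing_def emitted_def length_words)
      show "triple (?Inv q) copy_out_body 10 (?Inv (Suc q))" if q: "q < length ?c" for q
      proof (rule triple_run)
        fix s assume s: "?Inv q s"
        then have "arrs s aD q = ?c ! q" unfolding writing_def emitted_def stored_def using q by simp
        then show "?Inv (Suc q) (run copy_out_body s)"
          using s q written_put[of "?ws @ take q ?c" s "?c ! q"]
          by (simp add: copy_out_body_def writing_def parsed_def take_Suc_conv_app_nth)
      qed (simp_all add: copy_out_body_def)
    qed (simp add: len)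
    show "triple (?Inv (length ?c))
        (out (Num 5) ;; out (Cell aP (Reg rV)) ;; out (Reg rT) ;; incr rP ;; incr rI) 60
        (writing D P (Suc i) (ws @ [Suc (2 * length D), Suc (Suc (2 * length D))] @ ?c @
          [5, P v, 2 * length D]))"
    proof (rule triple_run)
      fix s assume s: "?Inv (length ?c) s"
      then have "written (?ws @ ?c) s" unfolding writing_def by simp
      then have "written ((?ws @ ?c) @ [5] @ [P v] @ [2 * length D])
          (put (2 * length D) (put (P v) (put 5 s)))"
        using written_put by (metis append_assoc)
      then show "writing D P (Suc i) (ws @ [Suc (2 * length D), Suc (Suc (2 * length D))] @ ?c @
          [5, P v, 2 * length D])
          (run (out (Num 5) ;; out (Cell aP (Reg rV)) ;; out (Reg rT) ;; incr rP ;; incr rI) s)"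
        using s by (simp add: writing_def parsed_def)
    qed simp_all
  qed simp
qed simp

lemma write_circuit:
  assumes i: "i < length X"
  shows "triple (writing D P i (output_upto D P i)) write_circuit
    (if P (X ! i) = 0 then 80 else 220 + 80 * length D)
    (writing D P (Suc i) (output_upto D P (Suc i)))"
  unfolding write_circuit_def
proof (rule triple_Seq)
  let ?mid = "\<lambda>s. writing D P i (output_upto D P i) s \<and> regs s rV = X ! i"
  show "triple (writing D P i (output_upto D P i)) (Assign rV (Cell aIn (Reg rP))) 3 ?mid"
    by (rule triple_run) (use input_outputs(2)[OF i] in \<open>auto simp: writing_def parsed_def\<close>)
  show "triple ?mid (If (Eq (Cell aP (Reg rV)) (Num 0)) write_bottom write_finished)
      (if P (X ! i) = 0 then 70 else 210 + 80 * length D)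
      (writing D P (Suc i) (output_upto D P (Suc i)))"
  proof (rule triple_If)
    show "test_val (Eq (Cell aP (Reg rV)) (Num 0)) s = (P (X ! i) = 0)" if "?mid s" for s
      using that by (simp add: writing_def)
    show "triple ?mid (if P (X ! i) = 0 then write_bottom else write_finished)
        (if P (X ! i) = 0 then 60 else 200 + 80 * length D)
        (writing D P (Suc i) (output_upto D P (Suc i)))"
    proof (cases "P (X ! i) = 0")
      case True
      then show ?thesis
        using triple_weaken[OF write_bottom[of D P i "output_upto D P i"], of ?mid]
        by (simp add: output_upto_Suc[OF i] enc_skolem_circuit)
    next
      case False
      then show ?thesis
        using write_finished[of D P i "output_upto D P i" "X ! i"]
        by (simp add: output_upto_Suc[OF i] enc_skolem_circuit)
    qed
  qed simp
qed simp

text \<open>At most \<open>k\<close> variables have a nonzero node (\<open>touched\<close>), and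
  distinct positions of \<open>X\<close> hold distinct variables. The estimate serves both running
  time and size.\<close>

lemma sum_outputs_le:
  assumes b: "build k = (D, P, N)"
  shows "(\<Sum>i<length X. if P (X ! i) = 0 then x else y) \<le> length X * x + k * (y :: nat)"
proof -
  let ?T = "{i. i < length X \<and> P (X ! i) \<noteq> 0}"
  have fin: "finite ?T" by simp
  have t: "finite {v. P v \<noteq> 0}" "card {v. P v \<noteq> 0} \<le> k" using touched[OF b] by simp_all
  have "inj_on ((!) X) ?T" using distinct_X by (auto simp: inj_on_def nth_eq_iff_index_eq)
  then have "card ?T = card ((!) X ` ?T)" by (simp add: card_image)
  also have "\<dots> \<le> card {v. P v \<noteq> 0}" by (rule card_mono[OF t(1)]) auto
  finally have card: "card ?T \<le> k" using t(2) by simp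
  have "(\<Sum>i<length X. if P (X ! i) = 0 then x else y) \<le>
      (\<Sum>i<length X. x + (if P (X ! i) \<noteq> 0 then y else 0))"
    by (rule sum_mono) simp
  also have "\<dots> = length X * x + (\<Sum>i<length X. if P (X ! i) \<noteq> 0 then y else 0)"
    by (simp add: sum.distrib)
  also have "(\<Sum>i<length X. if P (X ! i) \<noteq> 0 then y else 0) = sum (\<lambda>_. y) ?T"
    by (subst sum.inter_filter[symmetric]) (simp_all add: lessThan_def)
  also have "\<dots> \<le> k * y" using card by simp
  finally show ?thesis by simp
qed

lemma write_circuits:
  assumes b: "build k = (D, P, N)"
  shows "triple (chaining D P (length D)) write_circuits (40 + length X * 90 + k * (230 + 80 * length D))
    (writing D P (length X) (output_upto D P (length X)))"
  unfolding write_circuits_def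
proof (rule triple_Seq)
  show "triple (chaining D P (length D))
      (Assign rO (Num 0) ;; out (Reg rM) ;; Assign rI (Num 0) ;; Assign rP (Reg rX)) 20
      (writing D P 0 (output_upto D P 0))"
  proof (rule triple_run)
    fix s assume s: "chaining D P (length D) s"
    have "written [] (set_reg rO 0 s)" unfolding written_def stored_def by simp
    from written_put[OF this, of "length X"] s
    show "writing D P 0 (output_upto D P 0)
        (run (Assign rO (Num 0) ;; out (Reg rM) ;; Assign rI (Num 0) ;; Assign rP (Reg rX)) s)"
      by (simp add: chaining_def writing_def parsed_def output_upto_def chained_def)
  qed simp_all
  let ?T = "\<lambda>i. if P (X ! i) = 0 then 80 else 220 + 80 * length D"
  let ?b = "Less (Reg rI) (Reg rM)"
  show "triple (writing D P 0 (output_upto D P 0)) (While (Less (Reg rI) (Reg rM)) write_circuit)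
      (20 + length X * 90 + k * (230 + 80 * length D))
      (writing D P (length X) (output_upto D P (length X)))"
  proof (rule triple_While[where T = ?T and Inv = "\<lambda>i. writing D P i (output_upto D P i)"])
    show "test_val (Less (Reg rI) (Reg rM)) s = (i < length X)"
      if "writing D P i (output_upto D P i) s" for i s
      using that by (simp add: writing_def parsed_def)
    show "triple (writing D P i (output_upto D P i)) write_circuit (?T i)
        (writing D P (Suc i) (output_upto D P (Suc i)))" if "i < length X" for i
      using that by (rule write_circuit)
    have "(\<Sum>i<length X. ?T i + test_cost ?b) =
        (\<Sum>i<length X. if P (X ! i) = 0 then 83 else 223 + 80 * length D)"
      by (rule sum.cong) auto
    also have "\<dots> \<le> length X * 83 + k * (223 + 80 * length D)"
      by (rule sum_outputs_le[OF b])
    finally show "(\<Sum>i<length X. ?T i + test_cost ?b) + test_cost ?b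
      \<le> 20 + length X * 90 + k * (230 + 80 * length D)"
      by (simp add: add_mult_distrib2)
  qed
qed simp

section \<open>Size and time bounds\<close>

lemma vector_size_le:
  assumes b: "build k = (D, P, N)"
  shows "vector_size (map (\<lambda>v. skolem_circuit D (P v)) X) \<le> length X + k * (2 * length D + 2)"
proof -
  have inv: "built k D P N" using built_build b by simp
  have "csize (skolem_circuit D (P v)) = (if P v = 0 then 1 else 2 * length D + 2)"
    if "v \<in> set X" for v
  proof -
    have "sound_nodes (set I) D" "gate D (P v) (\<lambda>\<sigma>. repaired k \<sigma> v)"
      using inv that unfolding built_def by simp_all
    then show ?thesis
      using finished_correct(3) bottom_circuit_correct(3) unfolding skolem_circuit_def by simp
  qed
  then have "vector_size (map (\<lambda>v. skolem_circuit D (P v)) X) =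
      (\<Sum>i<length X. if P (X ! i) = 0 then 1 else 2 * length D + 2)"
    unfolding vector_size_def by (simp add: sum_list_sum_nth atLeast0LessThan)
  then show ?thesis using sum_outputs_le[OF b, of 1 "2 * length D + 2"] by simp
qed

text \<open>Each node contributes at most one variable, so at most \<open>n\<close> outputs occur in
  \<open>G\<close>; the rest are counted apart.\<close>

lemma length_X_le: "length X \<le> n + card (set X - circuit_vars G)"
proof -
  have sub: "circuit_vars G \<subseteq> (\<lambda>nd. lit_var (leaf_lit nd)) ` set (nodes G)"
    unfolding circuit_vars_def by force
  then have fin: "finite (circuit_vars G)" by (rule finite_subset) simp
  have "card (circuit_vars G) \<le> card (set (nodes G))"
    using sub by (meson List.finite_set card_image_le card_mono finite_imageI le_trans)
  also have "\<dots> \<le> n" unfolding csize_def by (rule card_length)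
  finally have "card (circuit_vars G) \<le> n" .
  moreover have "card (set X) \<le> card (circuit_vars G \<union> (set X - circuit_vars G))"
    using fin by (intro card_mono) auto
  moreover have "card (circuit_vars G \<union> (set X - circuit_vars G)) \<le>
      card (circuit_vars G) + card (set X - circuit_vars G)" by (rule card_Un_le)
  ultimately show ?thesis using distinct_card[OF distinct_X] by simp
qed

theorem program_correct:
  obtains t \<Psi> where "computes skolem_program (enc_input G Ls X I) t (enc_output \<Psi>)"
    "skolem_vector I X G \<Psi>"
    "vector_size \<Psi> \<le> 10000 * (k\<^sup>2 * n + card (set X - circuit_vars G))"
    "t \<le> 10000 * (k\<^sup>2 * n + card (set X - circuit_vars G))"
proof -
  obtain D P N where b: "build k = (D, P, N)" by (cases "build k")
  define \<Psi> where "\<Psi> = map (\<lambda>v. skolem_circuit D (P v)) X"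
  define R where "R = card (set X - circuit_vars G)"
  define K where "K = k\<^sup>2 * n"
  define T where "T = 240 + 20 * n + k * (380 + 1060 * n) + 20 * length X + 60 + 40 * length D +
    (40 + length X * 90 + k * (230 + 80 * length D))"
  have "triple (\<lambda>s. s = init_state (enc_input G Ls X I)) skolem_program T
      (writing D P (length X) (output_upto D P (length X)))"
    unfolding skolem_program_def
    by (rule triple_Seq[OF scan_nodes triple_Seq[OF scan_sets triple_Seq[OF scan_outputs
        triple_Seq[OF build_levels triple_Seq[OF build_chain[OF b] write_circuits[OF b] order.refl]
        order.refl] order.refl] order.refl]])
      (simp add: T_def add_mult_distrib2)
  then obtain t s where t: "exec skolem_program (init_state (enc_input G Ls X I)) t s" "t \<le> T"
    "writing D P (length X) (output_upto D P (length X)) s"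
    unfolding triple_def by blast
  have "output_upto D P (length X) = enc_output \<Psi>"
    unfolding output_upto_def enc_output_def enc_list_def \<Psi>_def by (simp add: comp_def)
  then have comp: "computes skolem_program (enc_input G Ls X I) t (enc_output \<Psi>)"
    using t unfolding computes_def writing_def written_def stored_def by auto
  have pos: "1 \<le> k" "1 \<le> n" using k_pos n_pos by linarith+
  have kn: "1 \<le> k * n" "k \<le> k * n" "n \<le> k * n"
    using mult_le_mono[OF pos] mult_le_mono2[OF pos(2), of k] mult_le_mono1[OF pos(1), of n] by simp_all
  have K: "k * n \<le> K"
    using mult_le_mono1[OF pos(1), of "k * n"] unfolding K_def power2_eq_square by (simp add: mult.assoc)
  have "length D \<le> 3 + (2 * (k * n) + 2 * k)"
    using length_build[OF b] by (simp add: algebra_simps)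
  \<comment> \<open>The factor 7 is 3 + 2 + 2, since 1 and \<open>k\<close> are at most
    \<open>k * n\<close>.\<close>
  then have L: "length D \<le> 7 * (k * n)" using kn by linarith
  have "k * length D \<le> k * (7 * (k * n))" using L by (rule mult_le_mono2)
  then have kL: "k * length D \<le> 7 * K" unfolding K_def power2_eq_square by (simp add: mult.assoc)
  have X: "length X \<le> n + R" using length_X_le unfolding R_def .
  have "vector_size \<Psi> \<le> length X + (2 * (k * length D) + 2 * k)"
    using vector_size_le[OF b] unfolding \<Psi>_def by (simp add: add_mult_distrib2)
  then have size: "vector_size \<Psi> \<le> 10000 * (K + R)"
    using X kL K kn unfolding add_mult_distrib2 by linarith
  \<comment> \<open>With every term bounded by multiples of \<open>K\<close> and \<open>R\<close>,
    the coefficients sum to 2980 for \<open>K\<close> and 110 for \<open>R\<close>, well below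
    10000.\<close>
  have "T = 340 + 20 * n + 610 * k + 1060 * (k * n) + 110 * length X + 40 * length D + 80 * (k * length D)"
    unfolding T_def by (simp add: add_mult_distrib2)
  then have time: "t \<le> 10000 * (K + R)"
    using t(2) X kL K kn L unfolding add_mult_distrib2 by linarith
  show thesis
    using that[OF comp] skolem_vector_build[OF b] size time unfolding \<Psi>_def K_def R_def by blast
qed

end

theorem theorem2:
  shows "\<exists>(p :: com) (c :: nat). \<forall>(I :: nat list) (X :: nat list) (G :: circuit) (Ls :: nat list list).
    distinct I \<and> distinct X \<and> set I \<inter> set X = {} \<and>
    circuit_over (set I \<union> set X) G \<and>
    (\<forall>L \<in> set Ls. distinct L) \<and>
    saunf I X G (map set Ls) \<longrightarrow>
    (\<exists>t \<Psi>. computes p (enc_input G Ls X I) t (enc_output \<Psi>) \<and>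
       skolem_vector I X G \<Psi> \<and>
       vector_size \<Psi> \<le> c * ((length Ls)\<^sup>2 * csize G + card (set X - circuit_vars G)) \<and>
       t \<le> c * ((length Ls)\<^sup>2 * csize G + card (set X - circuit_vars G)))"
proof (rule exI[of _ skolem_program], rule exI[of _ 10000], intro allI impI)
  fix I X :: "nat list" and G and Ls :: "nat list list"
  assume "distinct I \<and> distinct X \<and> set I \<inter> set X = {} \<and> circuit_over (set I \<union> set X) G \<and>
    (\<forall>L \<in> set Ls. distinct L) \<and> saunf I X G (map set Ls)"
  then interpret saunf_instance I X G Ls by unfold_locales simp_all
  show "\<exists>t \<Psi>. computes skolem_program (enc_input G Ls X I) t (enc_output \<Psi>) \<and>
      skolem_vector I X G \<Psi> \<and>
      vector_size \<Psi> \<le> 10000 * ((length Ls)\<^sup>2 * csize G + card (set X - circuit_vars G)) \<and>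
      t \<le> 10000 * ((length Ls)\<^sup>2 * csize G + card (set X - circuit_vars G))"
    by (rule program_correct) blast
qed

end
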